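(* Let $(Ku)(\xi)=\int_{-1}^1k(\xi-y)u(y)\,dy$, regarded as an operator from functions on $(-1,1)$ to functions on the line segment $(a,b)$ joining $a$ to $b$ in $\mathbb{C}$, where $k$ is smooth on $[-2,2]\setminus\{0\}$, and let $Lu=Au''+Bu'+Cu$. Then $$KL_{(-1,1)}u=L_{(a,b)}Ku\quad\text{for all }u\in C^\infty[-1,1],\qquad L_{(-1,1)}^*=L_{(-1,1)},\qquad L_{(a,b)}^*=L_{(a,b)}$$ holds for each of the following choices of $k$, $L$ and $(a,b)$: 1. $k(z)=\dfrac{\lambda}{\sinh\left(\frac\lambda2z\right)}\left(\alpha_1\dfrac{\sinh(\mu z)}{\mu}+\alpha_2\cosh(\mu z)\right)$ with $\alpha_1,\alpha_2\in\mathbb{C}$, $$A(y)=\frac1{\lambda^2}[\cosh(\lambda y)-\cosh\lambda],\qquad B(y)=A'(y),\qquad C(y)=\left(\frac{\lambda^2}{4}-\mu^2\right)A(y),$$ where $\lambda,\mu\in\mathbb{R}\cup i\mathbb{R}$, $\lambda\neq0$, and $a=-1+\frac{2\pi in}{\lambda}$, $b=1+\frac{2\pi in}{\lambda}$ with $n\in\mathbb{Z}$ (for $\mu=0$, $\frac{\sinh(\mu z)}{\mu}$ is read as $z$). When $\lambda\in i\mathbb{R}$ it is required in addition that either $|\lambda|<\pi$, or $\pi\le|\lambda|<2\pi$ with $\alpha_1=0$ and $\mu=\lambda\frac{2m+1}{4}$ for some $m\in\mathbb{Z}$. 2. $k(z)=\dfrac{1}{\sinh\left(\frac\lambda2z\right)}$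 and, with $A_0(y)=\cosh(\lambda y)-\cosh\lambda$, $$A(y)=\alpha A_0(y),\qquad B(y)=\alpha A_0'(y)+\beta A_0(y),\qquad C(y)=\frac\beta2A_0'(y)+\alpha\frac{\lambda^2}{4}A_0(y),$$ where $\beta\in i\mathbb{R}$, $\lambda\in\mathbb{R}\cup i\mathbb{R}$, $\lambda\ne0$, $\alpha\in\mathbb{R}$, and $a=-1+\frac{2\pi in}{\lambda}$, $b=1+\frac{2\pi in}{\lambda}$ with $n\in\mathbb{Z}$. 3. $k(z)=\dfrac1\beta+\dfrac1z$ and $$A(y)=(y^2-1)(y^2-b^2),\qquad B(y)=A'(y)+2\beta(y^2-1),\qquad C(y)=2\beta y,$$ where $\beta\in i\mathbb{R}$, $\beta\neq0$, $a=-b$ and $b>0$. 4. $k(z)=\dfrac1z$ and $$A(y)=(y^2-1)(y-a)(y-b),\qquad B(y)=A'(y)+\beta(y^2-1),\qquad C(y)=2y^2+(\beta-a-b)y,$$ where $\beta\in i\mathbb{R}$ and $a<b$ are real.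
   Context: Integrals through simple poles of $k$ are understood in the principal value sense. $L_{(-1,1)}$ and $L_{(a,b)}$ denote the differential expression $L$ acting on functions on the segments $(-1,1)$ and $(a,b)$ respectively; on $(a,b)$ the coefficients are the (entire) functions $A,B,C$ restricted to that segment. The relation $KL_{(-1,1)}u=L_{(a,b)}Ku$ is understood pointwise at points $\xi$ of the open segment $(a,b)$ other than those of the form $z_j\pm1$ with $z_j$ a pole of $k$ (where $Ku$ may have logarithmic singularities). For a segment on which $L$ acts, $L^*$ denotes the adjoint differential expression $$L^*u=\overline{A}u''+(2\overline{A}'-\overline{B})u'+(\overline{A}''-\overline{B}'+\overline{C})u,$$ and $L^*=L$ means equality of coefficients on the segment, i.e. $\operatorname{Im}A=0$, $\operatorname{Re}B=A'$ and $\operatorname{Im}C=\frac12\operatorname{Im}B'$ there. (All segments above are horizontal, so derivatives along the segment and derivatives in $y$ agree.) The leading coefficient $A$ vanishes at $\pm1$, $a$ and $b$. *)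

theory Defs
  imports "HOL-Complex_Analysis.Complex_Analysis"
begin

text \<open>
  Functions on a line segment are represented as functions \<open>complex \<Rightarrow> complex\<close>, of which only the
  values on the segment matter. Differentiation is always taken within the segment: a principal
  value integral \<open>Ku\<close> through a pole of the kernel is in general not complex differentiable, and
  \<open>\<lambda>x. cnj (A x)\<close> is not holomorphic for non-constant holomorphic \<open>A\<close>.
\<close>

definition deriv_within :: "complex set \<Rightarrow> (complex \<Rightarrow> complex) \<Rightarrow> complex \<Rightarrow> complex" where
  "deriv_within S f x = (SOME D. (f has_field_derivative D) (at x within S))"

text \<open>Infinite differentiability; one-sided derivatives are meant at endpoints belonging to \<open>S\<close>.\<close>

definition smooth_within :: "complex set \<Rightarrow> (complex \<Rightarrow> complex) \<Rightarrow> bool" where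
  "smooth_within S f \<longleftrightarrow>
     (\<exists>D :: nat \<Rightarrow> complex \<Rightarrow> complex.
        (\<forall>x\<in>S. D 0 x = f x) \<and>
        (\<forall>n. \<forall>x\<in>S. (D n has_field_derivative D (Suc n) x) (at x within S)))"

text \<open>The triple \<open>(A, B, C)\<close> stands for the differential expression \<open>A u'' + B u' + C u\<close>.\<close>

type_synonym diff_expr =
  "(complex \<Rightarrow> complex) \<times> (complex \<Rightarrow> complex) \<times> (complex \<Rightarrow> complex)"

fun diff_op :: "complex set \<Rightarrow> diff_expr \<Rightarrow> (complex \<Rightarrow> complex) \<Rightarrow> complex \<Rightarrow> complex" where
  "diff_op S (A, B, C) u x =
     A x * deriv_within S (deriv_within S u) x + B x * deriv_within S u x + C x * u x"

fun adjoint_expr :: "complex set \<Rightarrow> diff_expr \<Rightarrow> diff_expr" where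
  "adjoint_expr S (A, B, C) =
     ((\<lambda>x. cnj (A x)),
      (\<lambda>x. 2 * deriv_within S (\<lambda>y. cnj (A y)) x - cnj (B x)),
      (\<lambda>x. deriv_within S (deriv_within S (\<lambda>y. cnj (A y))) x
            - deriv_within S (\<lambda>y. cnj (B y)) x + cnj (C x)))"

fun expr_eq_on :: "complex set \<Rightarrow> diff_expr \<Rightarrow> diff_expr \<Rightarrow> bool" where
  "expr_eq_on S (A, B, C) (A', B', C') \<longleftrightarrow>
     (\<forall>x\<in>S. A x = A' x \<and> B x = B' x \<and> C x = C' x)"

text \<open>
  \<open>has_pv_integral f P I a b\<close>: the integral of \<open>f\<close> over \<open>[a, b]\<close>, with symmetric neighbourhoods of the
  singular points in \<open>P\<close> cut out, tends to \<open>I\<close>.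
\<close>

definition has_pv_integral ::
  "(real \<Rightarrow> complex) \<Rightarrow> real set \<Rightarrow> complex \<Rightarrow> real \<Rightarrow> real \<Rightarrow> bool" where
  "has_pv_integral f P I a b \<longleftrightarrow>
     (\<forall>\<^sub>F \<epsilon> in at_right 0. f integrable_on ({a..b} - (\<Union>p\<in>P. ball p \<epsilon>))) \<and>
     ((\<lambda>\<epsilon>. integral ({a..b} - (\<Union>p\<in>P. ball p \<epsilon>)) f) \<longlongrightarrow> I) (at_right 0)"

definition has_conv_integral ::
  "(complex \<Rightarrow> complex) \<Rightarrow> (complex \<Rightarrow> complex) \<Rightarrow> complex \<Rightarrow> complex \<Rightarrow> bool" where
  "has_conv_integral k u \<xi> I \<longleftrightarrow>
     has_pv_integral (\<lambda>y. k (\<xi> - of_real y) * u (of_real y))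
       {p \<in> {-1..1}. is_pole k (\<xi> - of_real p)} I (-1) 1"

definition conv_op ::
  "(complex \<Rightarrow> complex) \<Rightarrow> (complex \<Rightarrow> complex) \<Rightarrow> complex \<Rightarrow> complex" where
  "conv_op k u \<xi> = (THE I. has_conv_integral k u \<xi> I)"

text \<open>
  The relation \<open>K L u = L K u\<close> on \<open>(a, b)\<close> for all \<open>u \<in> C\<^sup>\<infinity>[-1, 1]\<close>, pointwise away from the
  points \<open>z \<plusminus> 1\<close> with \<open>z\<close> a pole of \<open>k\<close>. Since the operators above are total functions, the existence
  of the integrals and of both derivatives of \<open>Ku\<close> is asserted explicitly.
\<close>

definition intertwines ::
  "(complex \<Rightarrow> complex) \<Rightarrow> diff_expr \<Rightarrow> complex \<Rightarrow> complex \<Rightarrow> bool" where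
  "intertwines k L a b \<longleftrightarrow>
     (\<forall>u. smooth_within (closed_segment (-1) 1) u \<longrightarrow>
       (\<forall>\<xi>\<in>open_segment a b. (\<forall>z. is_pole k z \<longrightarrow> \<xi> \<noteq> z + 1 \<and> \<xi> \<noteq> z - 1) \<longrightarrow>
          (\<exists>I. has_conv_integral k u \<xi> I) \<and>
          (\<exists>I. has_conv_integral k (diff_op (open_segment (-1) 1) L u) \<xi> I) \<and>
          conv_op k u field_differentiable (at \<xi> within open_segment a b) \<and>
          deriv_within (open_segment a b) (conv_op k u)
            field_differentiable (at \<xi> within open_segment a b) \<and>
          conv_op k (diff_op (open_segment (-1) 1) L u) \<xi> =
            diff_op (open_segment a b) L (conv_op k u) \<xi>))"

end

theory Submission
  imports Defs
begin

text \<open>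
  In all four families the kernel is a quotient \<open>F / s\<close> of entire functions with \<open>s (z) = sinh (\<lambda> z / 2)\<close>
  or \<open>s (z) = z\<close>, so its poles are simple, and the differences \<open>A (\<xi>) - A (y)\<close>, \<open>B (\<xi>) - B (y)\<close>,
  \<open>C (\<xi>) - C (y)\<close> are divisible by \<open>s (\<xi> - y)\<close>. Two facts give the intertwining relation.

  First, \<open>(Ku)' (\<xi>) = (Ku') (\<xi>) + k (\<xi> + 1) u (-1) - k (\<xi> - 1) u (1)\<close> in the principal value sense
  (\<open>has_vector_derivative_conv_op\<close>). For a kernel without poles this is differentiation under the
  integral sign and integration by parts. Subtracting the principal parts at the finitely many poles
  that matter near \<open>\<xi>\<close> reduces the general case to the Hilbert transform
  (\<open>has_vector_derivative_hilbert\<close>). Applying the formula twice also gives the second derivative.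

  Second, \<open>LKu - KLu\<close> is therefore a sum of boundary terms and the principal value integral of
  \<open>k (\<xi> - y) ((A (\<xi>) - A (y)) u'' + (B (\<xi>) - B (y)) u' + (C (\<xi>) - C (y)) u)\<close>. Divisibility by
  \<open>s (\<xi> - y)\<close> makes the three coefficients entire in \<open>y\<close>, and the differential equation satisfied by
  the kernel says that the integrand is a total derivative \<open>(P u' + W u)'\<close>
  (\<open>has_conv_integral_diff_op\<close>). Since \<open>A\<close> vanishes at \<open>1\<close> and \<open>-1\<close> and \<open>B = A'\<close> there, its boundary
  values cancel the other boundary terms (\<open>boundary_values\<close>). The differential equation is checked
  for each family in the form stated at \<open>intertwines_quotientI\<close>.

  Self-adjointness only needs that \<open>A\<close> is real on the segments, that the real part of \<open>B\<close> is \<open>A'\<close>, and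
  that the imaginary part of \<open>C\<close> is half that of \<open>B'\<close>. For the hyperbolic families this rests on
  \<open>cosh (\<lambda> x)\<close> and \<open>\<lambda> sinh (\<lambda> x)\<close> being real along both segments.
\<close>

section \<open>Principal value integrals\<close>

lemma has_pv_integral_unique:
  assumes "has_pv_integral f P I a b" "has_pv_integral f P J a b"
  shows "I = J"
  using assms tendsto_unique[of "at_right (0::real)"] unfolding has_pv_integral_def by auto

lemma has_pv_integral_add:
  assumes "has_pv_integral f P I a b" "has_pv_integral g P J a b"
  shows "has_pv_integral (\<lambda>y. f y + g y) P (I + J) a b"
proof -
  let ?X = "\<lambda>\<epsilon>. {a..b} - (\<Union>p\<in>P. ball p \<epsilon>)"
  from assms have f: "\<forall>\<^sub>F \<epsilon> in at_right 0. f integrable_on ?X \<epsilon>"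
    and g: "\<forall>\<^sub>F \<epsilon> in at_right 0. g integrable_on ?X \<epsilon>"
    and lim: "((\<lambda>\<epsilon>. integral (?X \<epsilon>) f + integral (?X \<epsilon>) g) \<longlongrightarrow> I + J) (at_right 0)"
    unfolding has_pv_integral_def by (auto intro: tendsto_add)
  have "((\<lambda>\<epsilon>. integral (?X \<epsilon>) (\<lambda>y. f y + g y)) \<longlongrightarrow> I + J) (at_right 0)"
    by (rule Lim_transform_eventually[OF lim])
       (use f g in eventually_elim, simp add: integral_add)
  moreover have "\<forall>\<^sub>F \<epsilon> in at_right 0. (\<lambda>y. f y + g y) integrable_on ?X \<epsilon>"
    using f g by eventually_elim (rule integrable_add)
  ultimately show ?thesis unfolding has_pv_integral_def by simp
qed

lemma has_pv_integral_cmul: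
  assumes "has_pv_integral f P I a b"
  shows "has_pv_integral (\<lambda>y. c * f y) P (c * I) a b"
  using assms unfolding has_pv_integral_def
  by (auto intro!: tendsto_mult integrable_on_mult_right elim!: eventually_mono)

lemma has_pv_integral_sum:
  assumes "finite Z" "\<And>z. z \<in> Z \<Longrightarrow> has_pv_integral (f z) P (I z) a b"
  shows "has_pv_integral (\<lambda>y. \<Sum>z\<in>Z. f z y) P (\<Sum>z\<in>Z. I z) a b"
  using assms
proof (induction Z rule: finite_induct)
  case empty
  show ?case
    unfolding has_pv_integral_def integrable_on_def
    by (auto intro!: exI[of _ 0] has_integral_is_0)
next
  case (insert z Z)
  then show ?case by (simp add: has_pv_integral_add)
qed

text \<open>Finitely many values of the integrand do not matter.\<close>

lemma has_pv_integral_spike_finite: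
  assumes "has_pv_integral f P I a b" "finite N" "\<And>y. y \<in> {a..b} - N \<Longrightarrow> f y = g y"
  shows "has_pv_integral g P I a b"
proof -
  let ?X = "\<lambda>\<epsilon>. {a..b} - (\<Union>p\<in>P. ball p \<epsilon>)"
  have "g integrable_on ?X \<epsilon>" if "f integrable_on ?X \<epsilon>" for \<epsilon>
    by (rule integrable_spike_finite[OF assms(2) _ that]) (use assms(3) in auto)
  moreover have "integral (?X \<epsilon>) g = integral (?X \<epsilon>) f" for \<epsilon>
    by (rule integral_spike[OF negligible_finite[OF assms(2)]]) (use assms(3) in auto)
  ultimately show ?thesis
    using assms(1) unfolding has_pv_integral_def by (auto elim!: eventually_mono)
qed

text \<open>For an absolutely integrable function the holes close up by dominated convergence.\<close>

lemma has_pv_integral_absolutely_integrable: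
  fixes f :: "real \<Rightarrow> complex"
  assumes f: "f absolutely_integrable_on {a..b}" and "finite P"
  shows "has_pv_integral f P (integral {a..b} f) a b"
proof -
  let ?X = "\<lambda>\<epsilon>. {a..b} - (\<Union>p\<in>P. ball p \<epsilon>)"
  have int: "f integrable_on ?X \<epsilon>" for \<epsilon>
  proof -
    have "f absolutely_integrable_on ?X \<epsilon>"
      by (rule set_integrable_subset[OF f])
         (intro sets.Diff sets_completionI_sets, auto intro!: borel_open open_UN)
    then show ?thesis by (rule set_lebesgue_integral_eq_integral)
  qed
  have "((\<lambda>\<epsilon>. integral (?X \<epsilon>) f) \<longlongrightarrow> integral {a..b} f) (at_right 0)"
    unfolding tendsto_at_iff_sequentially o_def
  proof (intro allI impI)
    fix e :: "nat \<Rightarrow> real"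
    assume e: "\<forall>i. e i \<in> {0<..} - {0}" "e \<longlonglongrightarrow> 0"
    let ?g = "\<lambda>i y. if y \<in> ?X (e i) then f y else 0"
    let ?h = "\<lambda>y. if y \<in> P then 0 else f y"
    have fi: "f integrable_on {a..b}" and nf: "(\<lambda>y. norm (f y)) integrable_on {a..b}"
      using f unfolding absolutely_integrable_on_def by auto
    have "(\<lambda>i. integral {a..b} (?g i)) \<longlonglongrightarrow> integral {a..b} ?h"
    proof (rule dominated_convergence)
      show "?g i integrable_on {a..b}" for i
        by (rule integrable_restrict_Int[THEN iffD2]) (use int[of "e i"] in \<open>simp add: Int_absorb2 Diff_subset inf.absorb1\<close>)
      show "(\<lambda>y. norm (f y)) integrable_on {a..b}" by (rule nf)
      show "norm (?g i y) \<le> norm (f y)" for i y by simp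
      show "(\<lambda>i. ?g i y) \<longlonglongrightarrow> ?h y" if "y \<in> {a..b}" for y
      proof (cases "y \<in> P")
        case True
        then have "?g i y = 0" for i using e(1) by force
        with True show ?thesis by simp
      next
        case False
        have "\<forall>\<^sub>F i in sequentially. \<forall>p\<in>P. e i < dist p y"
        proof (rule eventually_ball_finite[OF \<open>finite P\<close>], rule ballI)
          fix p assume "p \<in> P"
          then show "\<forall>\<^sub>F i in sequentially. e i < dist p y"
            using False by (intro order_tendstoD[OF e(2)]) auto
        qed
        then have "\<forall>\<^sub>F i in sequentially. ?g i y = ?h y"
          by eventually_elim (use that False in \<open>force simp: not_less\<close>)
        then show ?thesis by (rule tendsto_eventually)
      qed
    qed
    moreover have "integral {a..b} (?g i) = integral (?X (e i)) f" for i
      by (subst integral_restrict_Int) (simp add: Int_absorb2 Diff_subset inf.absorb1)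
    moreover have "integral {a..b} ?h = integral {a..b} f"
      by (rule integral_spike[OF negligible_finite[OF \<open>finite P\<close>]]) auto
    ultimately show "(\<lambda>i. integral (?X (e i)) f) \<longlonglongrightarrow> integral {a..b} f" by simp
  qed
  then show ?thesis unfolding has_pv_integral_def using int by simp
qed

lemma has_pv_integral_continuous:
  fixes f :: "real \<Rightarrow> complex"
  assumes "continuous_on {a..b} f" "finite P"
  shows "has_pv_integral f P (integral {a..b} f) a b"
  using assms by (intro has_pv_integral_absolutely_integrable absolutely_integrable_continuous_real)


text \<open>
  The principal value of the Cauchy kernel. The set \<open>P\<close> may contain further points, because in the
  application the holes around all poles of the kernel are cut out simultaneously.
  Near \<open>x\<close> the integrand is odd and contributes nothing; on the rest of the interval it is continuous,
  so that the holes around the other points of \<open>P\<close> do not matter.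
\<close>

lemma has_pv_integral_Cauchy_kernel:
  assumes x: "x \<in> {-1<..<1}" and P: "x \<in> P" "finite P"
  shows "has_pv_integral (\<lambda>y. 1 / complex_of_real (x - y)) P (of_real (ln ((1 + x) / (1 - x)))) (-1) 1"
proof -
  define f where "f = (\<lambda>y. 1 / complex_of_real (x - y))"
  have f_eq: "f y = of_real (1 / (x - y))" for y by (simp add: f_def)
  have left: "(f has_integral of_real (ln (x - c) - ln (x - d))) {c..d}" if "c \<le> d" "d < x" for c d
  proof -
    have "((\<lambda>y. 1 / (x - y)) has_integral (- ln (x - d)) - (- ln (x - c))) {c..d}"
      using that
      by (intro fundamental_theorem_of_calculus)
         (auto simp: divide_simps simp flip: has_real_derivative_iff_has_vector_derivative
               intro!: derivative_eq_intros)
    from has_integral_linear[OF this bounded_linear_of_real]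
    show ?thesis by (simp add: f_eq[abs_def] o_def algebra_simps del: of_real_divide of_real_diff)
  qed
  have right: "(f has_integral of_real (ln (c - x) - ln (d - x))) {c..d}" if "c \<le> d" "x < c" for c d
  proof -
    have "((\<lambda>y. 1 / (x - y)) has_integral (- ln (d - x)) - (- ln (c - x))) {c..d}"
      using that
      by (intro fundamental_theorem_of_calculus)
         (auto simp: divide_simps simp flip: has_real_derivative_iff_has_vector_derivative
               intro!: derivative_eq_intros)
    from has_integral_linear[OF this bounded_linear_of_real]
    show ?thesis by (simp add: f_eq[abs_def] o_def algebra_simps del: of_real_divide of_real_diff)
  qed
  \<comment> \<open>Holes of radius below \<open>\<delta>\<close> around the other points of \<open>P\<close> do not meet the ball around \<open>x\<close>.\<close>
  obtain \<delta> where \<delta>: "\<delta> > 0" "\<delta> < 1 - x" "\<delta> < 1 + x" "\<And>p. p \<in> P \<Longrightarrow> p \<noteq> x \<Longrightarrow> 2 * \<delta> \<le> dist x p"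
  proof -
    obtain d where d: "d > 0" "\<And>p. p \<in> P \<Longrightarrow> p \<noteq> x \<Longrightarrow> d \<le> dist x p"
      using finite_set_avoid[OF P(2), of x] by (auto simp: dist_commute)
    show thesis
      by (rule that[of "min (d / 2) (min ((1 - x) / 2) ((1 + x) / 2))"])
         (use d x in \<open>force simp: min_def\<close>)+
  qed
  define T where "T = {-1..x - \<delta>} \<union> {x + \<delta>..1}"
  define f\<^sub>1 where "f\<^sub>1 y = (if y \<in> ball x \<delta> then f y else 0)" for y
  define f\<^sub>2 where "f\<^sub>2 y = (if y \<in> T then f y else 0)" for y

  have "f absolutely_integrable_on T"
    unfolding T_def
    by (intro set_integrable_Un absolutely_integrable_continuous_real)
       (use \<delta> in \<open>auto simp: f_def intro!: continuous_intros\<close>)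
  then have "f integrable_on T" "(\<lambda>y. norm (f y)) integrable_on T"
    unfolding absolutely_integrable_on_def by auto
  moreover have "T \<inter> {-1..1} = T"
    using \<delta> x by (auto simp: T_def)
  ultimately have "f\<^sub>2 integrable_on {-1..1}" "(\<lambda>y. if y \<in> T then norm (f y) else 0) integrable_on {-1..1}"
    unfolding f\<^sub>2_def[abs_def] by (simp_all add: integrable_restrict_Int)
  moreover have "(\<lambda>y. norm (f\<^sub>2 y)) = (\<lambda>y. if y \<in> T then norm (f y) else 0)"
    by (auto simp: f\<^sub>2_def)
  ultimately have "f\<^sub>2 absolutely_integrable_on {-1..1}"
    unfolding absolutely_integrable_on_def by simp
  from has_pv_integral_absolutely_integrable[OF this P(2)]
  have "has_pv_integral f\<^sub>2 P (integral {-1..1} f\<^sub>2) (-1) 1" .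
  moreover have "integral {-1..1} f\<^sub>2 = of_real (ln ((1 + x) / (1 - x)))"
  proof -
    have "(f has_integral of_real (ln (x - -1) - ln (x - (x - \<delta>))) +
             of_real (ln (x + \<delta> - x) - ln (1 - x))) T"
      unfolding T_def by (intro has_integral_Un left right) (use \<delta> in auto)
    then have "(f has_integral of_real (ln ((1 + x) / (1 - x)))) T"
      using x \<delta> by (simp add: ln_div add.commute)
    then have "(f\<^sub>2 has_integral of_real (ln ((1 + x) / (1 - x)))) {-1..1}"
      using \<delta> x unfolding f\<^sub>2_def T_def
      by (subst has_integral_restrict) auto
    then show ?thesis by (rule integral_unique)
  qed
  moreover have "has_pv_integral f\<^sub>1 P 0 (-1) 1"
  proof -
    let ?X = "\<lambda>\<epsilon>. {-1..1} - (\<Union>p\<in>P. ball p \<epsilon>)"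
    have *: "(f\<^sub>1 has_integral 0) (?X \<epsilon>)" if "0 < \<epsilon>" "\<epsilon> < \<delta>" for \<epsilon>
    proof -
      let ?U = "{x - \<delta>..x - \<epsilon>} \<union> {x + \<epsilon>..x + \<delta>}"
      have "(f has_integral of_real (ln (x - (x - \<delta>)) - ln (x - (x - \<epsilon>))) +
             of_real (ln (x + \<epsilon> - x) - ln (x + \<delta> - x))) ?U"
        by (intro has_integral_Un left right) (use that in auto)
      then have "(f has_integral 0) ?U" by simp
      then have int: "((\<lambda>y. if y \<in> ?U then f y else 0) has_integral 0) UNIV"
        by (simp only: has_integral_restrict_UNIV)
      have eq: "(if y \<in> ?X \<epsilon> then f\<^sub>1 y else 0) = (if y \<in> ?U then f y else 0)"
        if y: "y \<in> UNIV - {x - \<delta>, x + \<delta>}" for y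
      proof (cases "y \<in> ball x \<delta>")
        case True
        have "y \<notin> ball p \<epsilon>" if "p \<in> P" "p \<noteq> x" for p
          using True \<delta>(4)[OF that] \<open>\<epsilon> < \<delta>\<close> by (auto simp: dist_real_def)
        then have "y \<in> ?X \<epsilon> \<longleftrightarrow> y \<notin> ball x \<epsilon>"
          using True \<delta> x P by (auto simp: dist_real_def)
        also have "\<dots> \<longleftrightarrow> y \<in> ?U"
          using True \<open>0 < \<epsilon>\<close> by (auto simp: dist_real_def)
        finally show ?thesis using True by (simp only: f\<^sub>1_def if_True)
      next
        case False
        then have "y \<notin> ?U" using y \<open>0 < \<epsilon>\<close> by (auto simp: dist_real_def abs_if split: if_splits)
        with False show ?thesis by (simp only: f\<^sub>1_def if_False if_cancel)
      qed
      have "((\<lambda>y. if y \<in> ?X \<epsilon> then f\<^sub>1 y else 0) has_integral 0) UNIV"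
        by (rule has_integral_spike_finite[OF _ eq int, rotated]) (assumption | simp only: finite.intros)+
      then show ?thesis by (simp only: has_integral_restrict_UNIV)
    qed
    have ev: "\<forall>\<^sub>F \<epsilon> in at_right 0. 0 < \<epsilon> \<and> \<epsilon> < \<delta>"
      using \<delta>(1) eventually_at_right_less by (auto simp: eventually_at_right_field)
    have "\<forall>\<^sub>F \<epsilon> in at_right 0. f\<^sub>1 integrable_on ?X \<epsilon>"
      using ev by eventually_elim (use * in blast)
    moreover have "\<forall>\<^sub>F \<epsilon> in at_right 0. integral (?X \<epsilon>) f\<^sub>1 = 0"
      using ev by eventually_elim (use * in \<open>blast intro: integral_unique\<close>)
    ultimately show ?thesis
      unfolding has_pv_integral_def by (blast intro: tendsto_eventually)
  qed
  ultimately have "has_pv_integral (\<lambda>y. f\<^sub>1 y + f\<^sub>2 y) P (0 + of_real (ln ((1 + x) / (1 - x)))) (-1) 1"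
    by (intro has_pv_integral_add) simp_all
  moreover have "f\<^sub>1 y + f\<^sub>2 y = f y" if "y \<in> {-1..1}" for y
    using that by (auto simp: f\<^sub>1_def f\<^sub>2_def T_def dist_real_def)
  ultimately have "has_pv_integral f P (of_real (ln ((1 + x) / (1 - x)))) (-1) 1"
    using has_pv_integral_spike_finite[of "\<lambda>y. f\<^sub>1 y + f\<^sub>2 y" P _ "-1" 1 "{}" f] by simp
  then show ?thesis by (simp only: f_def)
qed

section \<open>The finite Hilbert transform\<close>

text \<open>
  For a primitive \<open>u\<close> of \<open>v\<close>, \<open>dquot v x y\<close> is the difference quotient \<open>(u y - u x) / (y - x)\<close>,
  written as the average of \<open>v\<close> over the segment from \<open>x\<close> to \<open>y\<close>. In this form it includes the
  diagonal and is as smooth in \<open>x\<close> and \<open>y\<close> as \<open>v\<close> is.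
\<close>

definition dquot :: "(real \<Rightarrow> complex) \<Rightarrow> real \<Rightarrow> real \<Rightarrow> complex" where
  "dquot v x y = integral {0..1} (\<lambda>s. v (x + s * (y - x)))"

text \<open>
  The finite Hilbert transform, that is the principal value of the integral of \<open>u y / (x - y)\<close> over
  \<open>[-1, 1]\<close> for \<open>x\<close> in the open interval. The argument \<open>v\<close> is the derivative of \<open>u\<close>; subtracting \<open>u x\<close>
  from \<open>u y\<close> leaves the logarithm and an integral of a smooth function.
\<close>

definition hilbert :: "(real \<Rightarrow> complex) \<Rightarrow> (real \<Rightarrow> complex) \<Rightarrow> real \<Rightarrow> complex" where
  "hilbert u v x = u x * of_real (ln ((1 + x) / (1 - x))) - integral {-1..1} (dquot v x)"

lemma segment_in_interval:
  fixes x y s :: real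
  assumes "x \<in> {-1..1}" "y \<in> {-1..1}" "s \<in> {0..1}"
  shows "x + s * (y - x) \<in> {-1..1}"
  using convexD_alt[OF convex_real_interval(5), of x "-1" 1 y s] assms by (simp add: algebra_simps)

lemma dquot_mult:
  assumes u: "\<And>x. x \<in> {-1..1} \<Longrightarrow> (u has_vector_derivative v x) (at x within {-1..1})"
    and xy: "x \<in> {-1..1}" "y \<in> {-1..1}"
  shows "of_real (y - x) * dquot v x y = u y - u x"
proof -
  have "((\<lambda>s. (y - x) *\<^sub>R v (x + s * (y - x))) has_integral u (x + 1 * (y - x)) - u (x + 0 * (y - x))) {0..1}"
  proof (rule fundamental_theorem_of_calculus)
    fix s :: real assume s: "s \<in> {0..1}"
    have sub: "(\<lambda>s. x + s * (y - x)) ` {0..1} \<subseteq> {-1..1}"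
      using segment_in_interval[OF xy] by blast
    have "((\<lambda>s. x + s * (y - x)) has_vector_derivative (y - x)) (at s within {0..1})"
      by (auto intro!: derivative_eq_intros simp flip: has_real_derivative_iff_has_vector_derivative)
    from vector_diff_chain_within[OF this has_vector_derivative_within_subset[OF u sub]]
    show "((\<lambda>s. u (x + s * (y - x))) has_vector_derivative (y - x) *\<^sub>R v (x + s * (y - x))) (at s within {0..1})"
      using segment_in_interval[OF xy s] by (simp add: o_def)
  qed simp
  from integral_unique[OF this] show ?thesis
    by (simp add: dquot_def scaleR_conv_of_real)
qed

lemma continuous_on_weighted_average:
  fixes w :: "real \<Rightarrow> real" and v :: "real \<Rightarrow> complex"
  assumes w: "continuous_on {0..1} w" and v: "continuous_on {-1..1} v"
  shows "continuous_on ({-1..1} \<times> {-1..1}) (\<lambda>(x, y). integral {0..1} (\<lambda>s. w s *\<^sub>R v (x + s * (y - x))))"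
proof -
  have "continuous_on (({-1..1} \<times> {-1..1}) \<times> cbox 0 1) (\<lambda>(p, s). w s *\<^sub>R v (fst p + s * (snd p - fst p)))"
    unfolding split_beta
    by (intro continuous_intros continuous_on_compose2[OF w] continuous_on_compose2[OF v])
       (use segment_in_interval in force)+
  from integral_continuous_on_param[OF this] show ?thesis
    by (simp add: split_beta)
qed

lemma continuous_on_dquot:
  assumes "continuous_on {-1..1} v"
  shows "continuous_on ({-1..1} \<times> {-1..1}) (\<lambda>(x, y). dquot v x y)"
  using continuous_on_weighted_average[OF continuous_on_const[of _ 1] assms] by (simp add: dquot_def)

lemma has_vector_derivative_dquot:
  assumes v: "\<And>x. x \<in> {-1..1} \<Longrightarrow> (v has_vector_derivative v' x) (at x within {-1..1})"
    and v': "continuous_on {-1..1} v'"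
    and xy: "x \<in> {-1..1}" "y \<in> {-1..1}"
  shows has_vector_derivative_dquot_left:
      "((\<lambda>x. dquot v x y) has_vector_derivative
         integral {0..1} (\<lambda>s. (1 - s) *\<^sub>R v' (x + s * (y - x)))) (at x within {-1..1})" (is ?left)
    and has_vector_derivative_dquot_right:
      "((\<lambda>y. dquot v x y) has_vector_derivative
         integral {0..1} (\<lambda>s. s *\<^sub>R v' (x + s * (y - x)))) (at y within {-1..1})" (is ?right)
proof -
  have contv: "continuous_on {-1..1} v"
    using v by (meson continuous_on_vector_derivative)
  have int: "(\<lambda>s. v (x + s * (y - x))) integrable_on cbox 0 1"
    if "x \<in> {-1..1}" "y \<in> {-1..1}" for x y
    unfolding cbox_interval
    by (intro integrable_continuous_real continuous_on_compose2[OF contv] continuous_intros)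
       (use segment_in_interval[OF that] in auto)
  show ?left
    unfolding dquot_def cbox_interval[of 0 1, symmetric]
  proof (rule leibniz_rule_vector_derivative)
    fix x s :: real assume xs: "x \<in> {-1..1}" "s \<in> cbox 0 1"
    have sub: "(\<lambda>x. x + s * (y - x)) ` {-1..1} \<subseteq> {-1..1}"
      using segment_in_interval[OF _ xy(2)] xs by (auto simp del: atLeastAtMost_iff)
    have "((\<lambda>x. x + s * (y - x)) has_vector_derivative (1 - s)) (at x within {-1..1})"
      by (auto intro!: derivative_eq_intros simp flip: has_real_derivative_iff_has_vector_derivative)
    from vector_diff_chain_within[OF this has_vector_derivative_within_subset[OF v sub]]
    show "((\<lambda>x. v (x + s * (y - x))) has_vector_derivative (1 - s) *\<^sub>R v' (x + s * (y - x)))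
            (at x within {-1..1})"
      using segment_in_interval[OF xs(1) xy(2), of s] xs by (simp add: o_def)
  next
    show "continuous_on ({-1..1} \<times> cbox 0 1) (\<lambda>(x, s). (1 - s) *\<^sub>R v' (x + s * (y - x)))"
      unfolding split_beta
      by (intro continuous_intros continuous_on_compose2[OF v'])
         (use segment_in_interval[OF _ xy(2)] in force)
  qed (use xy int in auto)
  show ?right
    unfolding dquot_def cbox_interval[of 0 1, symmetric]
  proof (rule leibniz_rule_vector_derivative)
    fix y s :: real assume ys: "y \<in> {-1..1}" "s \<in> cbox 0 1"
    have sub: "(\<lambda>y. x + s * (y - x)) ` {-1..1} \<subseteq> {-1..1}"
      using segment_in_interval[OF xy(1)] ys by (auto simp del: atLeastAtMost_iff)
    have "((\<lambda>y. x + s * (y - x)) has_vector_derivative s) (at y within {-1..1})"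
      by (auto intro!: derivative_eq_intros simp flip: has_real_derivative_iff_has_vector_derivative)
    from vector_diff_chain_within[OF this has_vector_derivative_within_subset[OF v sub]]
    show "((\<lambda>y. v (x + s * (y - x))) has_vector_derivative s *\<^sub>R v' (x + s * (y - x)))
            (at y within {-1..1})"
      using segment_in_interval[OF xy(1) ys(1), of s] ys by (simp add: o_def)
  next
    show "continuous_on ({-1..1} \<times> cbox 0 1) (\<lambda>(y, s). s *\<^sub>R v' (x + s * (y - x)))"
      unfolding split_beta
      by (intro continuous_intros continuous_on_compose2[OF v'])
         (use segment_in_interval[OF xy(1)] in force)
  qed (use xy int in auto)
qed

lemma has_pv_integral_hilbert:
  assumes u: "\<And>x. x \<in> {-1..1} \<Longrightarrow> (u has_vector_derivative v x) (at x within {-1..1})"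
    and v: "continuous_on {-1..1} v"
    and x: "x \<in> {-1<..<1}" and P: "x \<in> P" "finite P"
  shows "has_pv_integral (\<lambda>y. u y / of_real (x - y)) P (hilbert u v x) (-1) 1"
proof -
  have "has_pv_integral (dquot v x) P (integral {-1..1} (dquot v x)) (-1) 1"
    by (intro has_pv_integral_continuous P(2)
          continuous_on_compose2[OF continuous_on_dquot[OF v], of _ "Pair x", simplified])
       (use x in \<open>auto intro!: continuous_intros\<close>)
  from has_pv_integral_add[OF
      has_pv_integral_cmul[OF has_pv_integral_Cauchy_kernel[OF x P], of "u x"]
      has_pv_integral_cmul[OF this, of "-1"]]
  have "has_pv_integral (\<lambda>y. u x * (1 / of_real (x - y)) + - 1 * dquot v x y) P (hilbert u v x) (-1) 1"
    by (simp add: hilbert_def)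
  then show ?thesis
  proof (rule has_pv_integral_spike_finite[of _ _ _ _ _ "{x}"])
    fix y assume y: "y \<in> {-1..1} - {x}"
    have "of_real (y - x) * dquot v x y = u y - u x"
      by (rule dquot_mult[OF u]) (use x y in auto)
    with y show "u x * (1 / of_real (x - y)) + - 1 * dquot v x y = u y / of_real (x - y)"
      by (simp add: divide_simps) (simp add: algebra_simps)
  qed simp
qed

text \<open>
  Differentiation commutes with the Hilbert transform up to the boundary terms that a formal
  integration by parts produces.
\<close>

lemma has_vector_derivative_hilbert:
  assumes u: "\<And>x. x \<in> {-1..1} \<Longrightarrow> (u has_vector_derivative v x) (at x within {-1..1})"
    and v: "\<And>x. x \<in> {-1..1} \<Longrightarrow> (v has_vector_derivative w x) (at x within {-1..1})"
    and w: "continuous_on {-1..1} w"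
    and x: "x \<in> {-1<..<1}"
  shows "(hilbert u v has_vector_derivative
           hilbert v w x + u 1 / of_real (1 - x) + u (-1) / of_real (1 + x)) (at x)"
proof -
  have x': "x \<in> {-1..1}" using x by simp
  have contv: "continuous_on {-1..1} v"
    using v by (meson continuous_on_vector_derivative)
  let ?l = "\<lambda>x. ln ((1 + x) / (1 - x))"
  let ?dx = "\<lambda>x y. integral {0..1} (\<lambda>s. (1 - s) *\<^sub>R w (x + s * (y - x)))"
  let ?dy = "\<lambda>y. integral {0..1} (\<lambda>s. s *\<^sub>R w (x + s * (y - x)))"
  have contdx: "continuous_on ({-1..1} \<times> {-1..1}) (\<lambda>(x, y). ?dx x y)"
    by (rule continuous_on_weighted_average[OF _ w]) (auto intro!: continuous_intros)
  have intdx: "?dx x integrable_on {-1..1}"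
    by (intro integrable_continuous_real continuous_on_compose2[OF contdx, of _ "Pair x", simplified])
       (use x in \<open>auto intro!: continuous_intros\<close>)
  have intdq: "dquot v x integrable_on {-1..1}" if "x \<in> {-1..1}" for x
    by (intro integrable_continuous_real
          continuous_on_compose2[OF continuous_on_dquot[OF contv], of _ "Pair x", simplified])
       (use that in \<open>auto intro!: continuous_intros\<close>)

  have "((\<lambda>x. integral (cbox (-1) 1) (dquot v x)) has_vector_derivative
          integral (cbox (-1) 1) (?dx x)) (at x within {-1..1})"
    by (rule leibniz_rule_vector_derivative)
       (use x' contdx intdq has_vector_derivative_dquot_left[OF v w] in auto)
  then have 1: "((\<lambda>x. integral {-1..1} (dquot v x)) has_vector_derivative integral {-1..1} (?dx x)) (at x)"
    using at_within_Icc_at[of "-1" x 1] x by simp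

  have dy: "(?dy has_integral dquot v x 1 - dquot v x (-1)) {-1..1}"
    by (rule fundamental_theorem_of_calculus)
       (use x' in \<open>auto intro!: has_vector_derivative_dquot_right[OF v w]\<close>)
  \<comment> \<open>Translating both arguments: the two partial derivatives of the difference quotient of \<open>u\<close> add up
    to the difference quotient of \<open>v\<close>.\<close>
  have "?dx x y + ?dy y = dquot w x y" if y: "y \<in> {-1..1}" for y
  proof -
    have c: "continuous_on {0..1} (\<lambda>s. w (x + s * (y - x)))"
      by (intro continuous_on_compose2[OF w] continuous_intros)
         (use segment_in_interval[OF x' y] in auto)
    have "?dx x y + ?dy y = integral {0..1} (\<lambda>s. (1 - s) *\<^sub>R w (x + s * (y - x)) + s *\<^sub>R w (x + s * (y - x)))"
      by (rule integral_add[symmetric]) (intro integrable_continuous_real continuous_intros c)+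
    also have "\<dots> = dquot w x y"
      unfolding dquot_def by (rule integral_cong) (simp flip: scaleR_left.add)
    finally show ?thesis .
  qed
  then have "integral {-1..1} (dquot w x) = integral {-1..1} (\<lambda>y. ?dx x y + ?dy y)"
    by (intro integral_cong) simp
  also have "\<dots> = integral {-1..1} (?dx x) + (dquot v x 1 - dquot v x (-1))"
    using dy intdx by (subst integral_add) (auto simp: integral_unique)
  finally have 2: "integral {-1..1} (?dx x) = integral {-1..1} (dquot w x) - (dquot v x 1 - dquot v x (-1))"
    by simp

  have "(u has_vector_derivative v x) (at x)"
    using u[OF x'] at_within_Icc_at[of "-1" x 1] x by simp
  moreover have "((\<lambda>x. complex_of_real (?l x)) has_vector_derivative of_real (1 / (1 + x) + 1 / (1 - x))) (at x)"
  proof -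
    have "(?l has_real_derivative 1 / (1 + x) + 1 / (1 - x)) (at x)"
      using x by (auto intro!: derivative_eq_intros simp: divide_simps)
    then show ?thesis
      using has_vector_derivative_of_real
      by (simp only: has_real_derivative_iff_has_vector_derivative has_vector_derivative_of_real)
  qed
  ultimately have "(hilbert u v has_vector_derivative
      u x * of_real (1 / (1 + x) + 1 / (1 - x)) + v x * of_real (?l x) - integral {-1..1} (?dx x)) (at x)"
    unfolding hilbert_def[abs_def]
    by (intro has_vector_derivative_diff 1 has_vector_derivative_mult)
  also have "u x * of_real (1 / (1 + x) + 1 / (1 - x)) + v x * of_real (?l x) - integral {-1..1} (?dx x) =
     hilbert v w x + u 1 / of_real (1 - x) + u (-1) / of_real (1 + x)"
  proof -
    have "dquot v x 1 = (u 1 - u x) / of_real (1 - x)"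
      using dquot_mult[OF u x', of 1] x by (simp add: field_simps)
    moreover have "- dquot v x (-1) = (u (-1) - u x) / of_real (1 + x)"
    proof -
      have "of_real (1 + x) \<noteq> (0::complex)" using x by (simp only: of_real_eq_0_iff) auto
      then show ?thesis
        using dquot_mult[OF u x', of "-1"] x by (simp add: divide_simps) (simp add: algebra_simps)
    qed
    ultimately show ?thesis
      unfolding 2 hilbert_def by (simp add: diff_divide_distrib distrib_left)
  qed
  finally show ?thesis .
qed

section \<open>Meromorphic kernels with simple poles\<close>

text \<open>
  Kernels that are meromorphic on the plane with at most simple poles. Removable singularities,
  where the value of \<open>k\<close> is arbitrary, are allowed: this corresponds to \<open>r = 0\<close>.
\<close>

locale simple_pole_kernel =
  fixes k :: "complex \<Rightarrow> complex"
  assumes laurent: "\<exists>r g. g analytic_on {z} \<and> (\<forall>\<^sub>F w in at z. k w = r / (w - z) + g w)"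
begin

text \<open>The residue at a simple pole, and \<open>0\<close> at every other point.\<close>

definition pole_coeff :: "complex \<Rightarrow> complex" where
  "pole_coeff z = (SOME r. \<exists>g. g analytic_on {z} \<and> (\<forall>\<^sub>F w in at z. k w = r / (w - z) + g w))"

lemma obtain_regular_part:
  obtains g where "g analytic_on {z}" "\<forall>\<^sub>F w in at z. k w = pole_coeff z / (w - z) + g w"
  using someI_ex[OF laurent[of z]] unfolding pole_coeff_def by blast

abbreviation poles :: "complex set" where "poles \<equiv> {z. is_pole k z}"

abbreviation singularities :: "complex set" where "singularities \<equiv> {z. \<not> k analytic_on {z}}"

lemma isolated_singularity: "isolated_singularity_at k z"
proof -
  obtain g where g: "g analytic_on {z}" "\<forall>\<^sub>F w in at z. k w = pole_coeff z / (w - z) + g w"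
    by (rule obtain_regular_part)
  obtain e where e: "e > 0" "g holomorphic_on ball z e"
    using g(1) by (auto simp: analytic_on_def)
  then have "(\<lambda>w. pole_coeff z / (w - z) + g w) holomorphic_on ball z e - {z}"
    by (intro holomorphic_intros) (auto intro: holomorphic_on_subset)
  then have "isolated_singularity_at (\<lambda>w. pole_coeff z / (w - z) + g w) z"
    using e(1) unfolding isolated_singularity_at_def
    by (auto simp: analytic_on_open open_Diff)
  with g(2) show ?thesis using isolated_singularity_at_cong by fast
qed

lemma not_islimpt_singularities: "\<not> z islimpt singularities"
proof -
  obtain e where e: "e > 0" "k analytic_on ball z e - {z}"
    using isolated_singularity[of z] unfolding isolated_singularity_at_def by blast
  then have "y = z" if "y \<in> singularities" "y \<in> ball z e" for y
    using that by (auto intro: analytic_on_subset)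
  with e(1) show ?thesis
    unfolding islimpt_def by (metis centre_in_ball open_ball)
qed

lemma pole_imp_singularity: "poles \<subseteq> singularities"
  by (auto simp: analytic_at dest: not_is_pole_holomorphic)

lemma closed_poles: "closed Z" if "Z \<subseteq> poles"
  unfolding closed_limpt
  using not_islimpt_singularities islimpt_subset that pole_imp_singularity by (metis order_trans)

lemma finite_singularities_in_compact:
  assumes "compact K"
  shows "finite (K \<inter> singularities)"
  by (rule finite_not_islimpt_in_compact[OF assms not_islimpt_singularities])

lemma tendsto_regular_point:
  assumes "pole_coeff z = 0" "g analytic_on {z}" "\<forall>\<^sub>F w in at z. k w = pole_coeff z / (w - z) + g w"
  shows "k \<midarrow>z\<rightarrow> g z"
  by (rule Lim_transform_eventually[of g])
     (use assms in \<open>auto simp: isCont_def dest!: analytic_at_imp_isCont elim!: eventually_mono\<close>)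

lemma pole_coeff_eq_0_iff: "pole_coeff z = 0 \<longleftrightarrow> \<not> is_pole k z"
proof -
  obtain g where g: "g analytic_on {z}" "\<forall>\<^sub>F w in at z. k w = pole_coeff z / (w - z) + g w"
    by (rule obtain_regular_part)
  have "\<not> is_pole k z" if "pole_coeff z = 0"
    using tendsto_regular_point[OF that g] not_tendsto_and_filterlim_at_infinity[of "at z"]
    by (auto simp: is_pole_def)
  moreover have "is_pole k z" if "pole_coeff z \<noteq> 0"
  proof -
    have "is_pole (\<lambda>w. (pole_coeff z + (w - z) * g w) / (w - z)) z"
      by (rule is_pole_divide)
         (use that g(1) in \<open>auto intro!: continuous_intros filterlim_atI tendsto_eq_intros
            simp: analytic_at_imp_isCont eventually_at_filter\<close>)
    also have "?this \<longleftrightarrow> is_pole k z"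
      by (rule is_pole_cong)
         (use g(2) in \<open>auto simp: eventually_at_filter field_simps elim!: eventually_mono\<close>)
    finally show ?thesis .
  qed
  ultimately show ?thesis by blast
qed

text \<open>
  What remains of the kernel when the principal parts at the points of \<open>Z\<close> are subtracted, with all
  removable singularities removed.
\<close>

definition regular_part :: "complex set \<Rightarrow> complex \<Rightarrow> complex" where
  "regular_part Z = remove_sings (\<lambda>w. k w - (\<Sum>z\<in>Z. pole_coeff z / (w - z)))"

lemma regular_part:
  assumes "finite Z" "w \<in> Z \<or> \<not> is_pole k w"
  shows analytic_regular_part: "regular_part Z analytic_on {w}"
    and regular_part_eq:
      "w \<notin> Z \<Longrightarrow> regular_part Z w = remove_sings k w - (\<Sum>z\<in>Z. pole_coeff z / (w - z))"
proof -
  obtain g where g: "g analytic_on {w}" "\<forall>\<^sub>F v in at w. k v = pole_coeff w / (v - w) + g v"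
    by (rule obtain_regular_part)
  define G where "G v = g v - (\<Sum>z\<in>Z - {w}. pole_coeff z / (v - z))" for v
  have G: "G analytic_on {w}"
    unfolding G_def by (intro analytic_intros g(1)) auto
  have "\<forall>\<^sub>F v in at w. k v - (\<Sum>z\<in>Z. pole_coeff z / (v - z)) = G v"
    using g(2)
  proof eventually_elim
    case (elim v)
    show ?case
    proof (cases "w \<in> Z")
      case True
      then have "(\<Sum>z\<in>Z. pole_coeff z / (v - z)) = pole_coeff w / (v - w) + (\<Sum>z\<in>Z - {w}. pole_coeff z / (v - z))"
        using assms(1) by (simp add: sum.remove)
      with elim show ?thesis by (simp add: G_def)
    next
      case False
      with assms(2) have "pole_coeff w = 0" by (simp add: pole_coeff_eq_0_iff)
      with elim False show ?thesis by (simp add: G_def)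
    qed
  qed
  then have ev: "\<forall>\<^sub>F v in at w. G v = k v - (\<Sum>z\<in>Z. pole_coeff z / (v - z))"
    by (simp add: eq_commute)
  have lim: "(\<lambda>v. k v - (\<Sum>z\<in>Z. pole_coeff z / (v - z))) \<midarrow>w\<rightarrow> G w"
    by (rule Lim_transform_eventually[OF _ ev])
       (use G in \<open>auto simp: isCont_def dest!: analytic_at_imp_isCont\<close>)
  moreover have "isolated_singularity_at (\<lambda>v. k v - (\<Sum>z\<in>Z. pole_coeff z / (v - z))) w"
    using isolated_singularity_at_cong[OF ev refl] isolated_singularity_at_analytic[OF G] by simp
  ultimately show "regular_part Z analytic_on {w}"
    unfolding regular_part_def by (intro remove_sings_analytic_at)
  assume w: "w \<notin> Z"
  with assms(2) have "pole_coeff w = 0" by (simp add: pole_coeff_eq_0_iff)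
  from tendsto_regular_point[OF this g] have "remove_sings k w = g w" by blast
  moreover have "regular_part Z w = G w"
    unfolding regular_part_def using lim by blast
  ultimately show "regular_part Z w = remove_sings k w - (\<Sum>z\<in>Z. pole_coeff z / (w - z))"
    using w by (simp add: G_def)
qed

lemma analytic_remove_sings: "remove_sings k analytic_on {w}" if "\<not> is_pole k w"
  using analytic_regular_part[of "{}" w] that by (simp add: regular_part_def)

end

section \<open>Differentiation of principal value convolutions\<close>

text \<open>A smooth function on \<open>[-1, 1]\<close> together with all its derivatives: \<open>D n\<close> is the \<open>n\<close>-th one.\<close>

definition smooth_seq :: "(nat \<Rightarrow> complex \<Rightarrow> complex) \<Rightarrow> bool" where
  "smooth_seq D \<longleftrightarrow> (\<forall>n. \<forall>x\<in>closed_segment (-1) 1.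
     (D n has_field_derivative D (Suc n) x) (at x within closed_segment (-1) 1))"

lemma closed_segment_complex_unit: "closed_segment (-1) 1 = complex_of_real ` {-1..1}"
  using closed_segment_of_real[of "-1" 1, where ?'a = complex] by (simp add: closed_segment_eq_real_ivl)

lemma smooth_seqD:
  assumes "smooth_seq D" "x \<in> {-1..1}"
  shows "((\<lambda>x. D n (of_real x)) has_vector_derivative D (Suc n) (of_real x)) (at x within {-1..1})"
proof -
  have "(of_real has_vector_derivative (1::complex)) (at x within {-1..1})"
    by (rule derivative_eq_intros refl | simp)+
  moreover have "(D n has_field_derivative D (Suc n) (of_real x)) (at (of_real x) within of_real ` {-1..1})"
    using assms unfolding smooth_seq_def closed_segment_complex_unit by auto
  ultimately show ?thesis
    using field_vector_diff_chain_within[of of_real 1 x "{-1..1}" "D n"] by (simp add: o_def)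
qed

lemma smooth_seq_continuous: "continuous_on {-1..1} (\<lambda>x. D n (of_real x))" if "smooth_seq D"
  using smooth_seqD[OF that] by (meson continuous_on_vector_derivative)

context simple_pole_kernel
begin

text \<open>The points at which \<open>Ku\<close> has no logarithmic singularity.\<close>

definition regular_point :: "complex \<Rightarrow> bool" where
  "regular_point \<xi> \<longleftrightarrow> (\<forall>z. is_pole k z \<longrightarrow> \<xi> \<noteq> z + 1 \<and> \<xi> \<noteq> z - 1)"

lemma open_regular_points: "open {\<xi>. regular_point \<xi>}"
proof -
  have "{\<xi>. regular_point \<xi>} = - ((+) 1 ` poles \<union> (+) (-1) ` poles)"
    by (auto simp: regular_point_def)
  moreover have "open \<dots>"
    by (intro open_Compl closed_Un closed_translation closed_poles order_refl)
  ultimately show ?thesis by (simp only:)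
qed

lemma finite_singular_parameters: "finite {y \<in> {-1..1}. \<xi> - of_real y \<in> singularities}"
proof -
  have "finite ((\<lambda>y. \<xi> - complex_of_real y) ` {-1..1} \<inter> singularities)"
    by (intro finite_singularities_in_compact compact_continuous_image continuous_intros) simp
  then have "finite ((\<lambda>y. \<xi> - complex_of_real y) ` {y \<in> {-1..1}. \<xi> - of_real y \<in> singularities})"
    by (rule finite_subset[rotated]) blast
  then show ?thesis by (rule finite_imageD) (auto simp: inj_on_def)
qed

lemma finite_pole_parameters: "finite {y \<in> {-1..1}. is_pole k (\<xi> - of_real y)}"
  using pole_imp_singularity by (intro finite_subset[OF _ finite_singular_parameters[of \<xi>]]) auto

lemma conv_op_eq: "conv_op k u \<xi> = I" if "has_conv_integral k u \<xi> I"
  unfolding conv_op_def using that has_pv_integral_unique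
  by (intro the_equality) (auto simp: has_conv_integral_def)

text \<open>The poles of \<open>k\<close> that meet the domain of integration at \<open>\<xi>\<close>.\<close>

definition poles_at :: "complex \<Rightarrow> complex set" where
  "poles_at \<xi> = (\<lambda>y. \<xi> - complex_of_real y) ` {-1..1} \<inter> poles"

lemma finite_poles_at: "finite (poles_at \<xi>)"
proof -
  have "finite ((\<lambda>y. \<xi> - complex_of_real y) ` {-1..1} \<inter> singularities)"
    by (intro finite_singularities_in_compact compact_continuous_image continuous_intros) simp
  then show ?thesis
    unfolding poles_at_def by (rule finite_subset[rotated]) (use pole_imp_singularity in blast)
qed

lemma poles_at_parameter:
  assumes "regular_point \<xi>" "z \<in> poles_at \<xi>"
  shows "\<xi> - z = of_real (Re (\<xi> - z))" "Re (\<xi> - z) \<in> {-1<..<1}"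
proof -
  obtain y where y: "y \<in> {-1..1}" "z = \<xi> - of_real y" "is_pole k z"
    using assms(2) by (auto simp: poles_at_def)
  then show "\<xi> - z = of_real (Re (\<xi> - z))" by simp
  have "y \<noteq> 1" "y \<noteq> -1"
    using y assms(1) by (auto simp: regular_point_def)
  with y show "Re (\<xi> - z) \<in> {-1<..<1}" by simp
qed

text \<open>The open set on which the regular part of \<open>k\<close> at \<open>\<xi>\<close> is holomorphic; it contains \<open>\<xi> - [-1, 1]\<close>.\<close>

definition kernel_domain :: "complex \<Rightarrow> complex set" where
  "kernel_domain \<xi> = - (poles - poles_at \<xi>)"

lemma open_kernel_domain: "open (kernel_domain \<xi>)"
  unfolding kernel_domain_def by (intro open_Compl closed_poles) blast

lemma holomorphic_regular_part: "regular_part (poles_at \<xi>) holomorphic_on kernel_domain \<xi>"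
  by (rule analytic_imp_holomorphic, subst analytic_on_analytic_at)
     (auto simp: kernel_domain_def intro!: analytic_regular_part finite_poles_at)

lemma kernel_domain_nhds:
  obtains \<delta> where "\<delta> > 0" "\<And>t y. \<bar>t\<bar> < \<delta> \<Longrightarrow> y \<in> {-1..1} \<Longrightarrow> \<xi> + of_real t - of_real y \<in> kernel_domain \<xi>"
proof -
  let ?T = "(\<lambda>y. \<xi> - complex_of_real y) ` {-1..1}"
  have "compact ?T"
    by (intro compact_continuous_image continuous_intros) simp
  moreover have "?T \<subseteq> kernel_domain \<xi>"
    by (auto simp: kernel_domain_def poles_at_def)
  ultimately obtain \<delta> where \<delta>: "\<delta> > 0" "(\<Union>w\<in>?T. ball w \<delta>) \<subseteq> kernel_domain \<xi>"
    using compact_subset_open_imp_ball_epsilon_subset open_kernel_domain by metis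
  have "\<xi> + of_real t - of_real y \<in> kernel_domain \<xi>" if "\<bar>t\<bar> < \<delta>" "y \<in> {-1..1}" for t y
  proof -
    have "\<xi> + of_real t - of_real y \<in> ball (\<xi> - of_real y) \<delta>"
      using that(1) by (simp add: dist_norm)
    with \<delta>(2) that(2) show ?thesis by blast
  qed
  with \<delta>(1) show thesis by (rule that)
qed

text \<open>The contribution of the regular part to \<open>Ku\<close> at the point \<open>\<xi> + t\<close>.\<close>

definition smooth_conv :: "complex \<Rightarrow> (real \<Rightarrow> complex) \<Rightarrow> real \<Rightarrow> complex" where
  "smooth_conv \<xi> u t = integral {-1..1} (\<lambda>y. regular_part (poles_at \<xi>) (\<xi> + of_real t - of_real y) * u y)"

text \<open>
  The value of \<open>K (D n)\<close> at \<open>\<xi> + t\<close> for small real \<open>t\<close>: each pole \<open>z\<close> in reach contributes a Hilbert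
  transform at the parameter \<open>\<xi> - z + t\<close>. As \<open>\<xi>\<close> moves horizontally, the poles in reach remain the
  same and their parameters stay inside \<open>(-1, 1)\<close>, provided that \<open>\<xi>\<close> is a regular point.
\<close>

definition conv_formula :: "complex \<Rightarrow> (nat \<Rightarrow> complex \<Rightarrow> complex) \<Rightarrow> nat \<Rightarrow> real \<Rightarrow> complex" where
  "conv_formula \<xi> D n t =
     (\<Sum>z\<in>poles_at \<xi>. pole_coeff z *
        hilbert (\<lambda>x. D n (of_real x)) (\<lambda>x. D (Suc n) (of_real x)) (Re (\<xi> - z) + t)) +
     smooth_conv \<xi> (\<lambda>x. D n (of_real x)) t"

lemma continuous_regular_part:
  assumes "\<And>y. y \<in> S \<Longrightarrow> \<xi> + f y \<in> kernel_domain \<xi>" "continuous_on S f"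
  shows "continuous_on S (\<lambda>y. regular_part (poles_at \<xi>) (\<xi> + f y))"
  by (rule continuous_on_compose2[OF holomorphic_on_imp_continuous_on[OF holomorphic_regular_part]])
     (use assms in \<open>auto intro!: continuous_intros\<close>)

lemma has_conv_integral_local:
  assumes \<xi>: "regular_point \<xi>" and D: "smooth_seq D"
  shows "\<forall>\<^sub>F t in nhds 0. has_conv_integral k (D n) (\<xi> + of_real t) (conv_formula \<xi> D n t)"
proof -
  let ?Z = "poles_at \<xi>" and ?u = "\<lambda>n x. D n (complex_of_real x)"
  obtain \<delta> where \<delta>: "\<delta> > 0"
    "\<And>t y. \<bar>t\<bar> < \<delta> \<Longrightarrow> y \<in> {-1..1} \<Longrightarrow> \<xi> + of_real t - of_real y \<in> kernel_domain \<xi>"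
    using kernel_domain_nhds by blast
  have "\<forall>\<^sub>F t in nhds 0. \<forall>z\<in>?Z. Re (\<xi> - z) + t \<in> {-1<..<1}"
  proof (rule eventually_ball_finite[OF finite_poles_at], rule ballI)
    fix z assume "z \<in> ?Z"
    then have "Re (\<xi> - z) + 0 \<in> {-1<..<1}"
      using poles_at_parameter[OF \<xi>] by auto
    moreover have "((\<lambda>t. Re (\<xi> - z) + t) \<longlongrightarrow> Re (\<xi> - z) + 0) (nhds 0)"
      by (intro tendsto_intros filterlim_ident)
    ultimately show "\<forall>\<^sub>F t in nhds 0. Re (\<xi> - z) + t \<in> {-1<..<1}"
      by (intro topological_tendstoD) auto
  qed
  moreover have "\<forall>\<^sub>F t in nhds 0. \<bar>t\<bar> < \<delta>"
    using \<delta>(1) by (auto simp: eventually_nhds_metric dist_real_def)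
  ultimately show ?thesis
  proof eventually_elim
    case (elim t)
    let ?\<xi> = "\<xi> + of_real t"
    let ?P = "{y \<in> {-1..1}. is_pole k (?\<xi> - of_real y)}"
    have x_in_P: "Re (\<xi> - z) + t \<in> ?P" if "z \<in> ?Z" for z
    proof -
      have "?\<xi> - of_real (Re (\<xi> - z) + t) = z"
        using poles_at_parameter(1)[OF \<xi> that] by (simp add: algebra_simps)
      then have "is_pole k (?\<xi> - of_real (Re (\<xi> - z) + t))"
        using that by (simp only: poles_at_def) simp
      moreover have "Re (\<xi> - z) + t \<in> {-1..1}" using elim(1) that by force
      ultimately show ?thesis by blast
    qed
    have "has_pv_integral (\<lambda>y. pole_coeff z * (?u n y / of_real (Re (\<xi> - z) + t - y))) ?P
        (pole_coeff z * hilbert (?u n) (?u (Suc n)) (Re (\<xi> - z) + t)) (-1) 1" if "z \<in> ?Z" for z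
      using elim(1) that x_in_P[OF that]
      by (intro has_pv_integral_cmul has_pv_integral_hilbert smooth_seqD smooth_seq_continuous D
            finite_pole_parameters) auto
    from has_pv_integral_sum[OF finite_poles_at this]
    have "has_pv_integral (\<lambda>y. \<Sum>z\<in>?Z. pole_coeff z * (?u n y / of_real (Re (\<xi> - z) + t - y))) ?P
        (\<Sum>z\<in>?Z. pole_coeff z * hilbert (?u n) (?u (Suc n)) (Re (\<xi> - z) + t)) (-1) 1" by simp
    moreover have "has_pv_integral (\<lambda>y. regular_part ?Z (?\<xi> - of_real y) * ?u n y) ?P
        (smooth_conv \<xi> (?u n) t) (-1) 1"
    proof -
      have "continuous_on {-1..1} (\<lambda>y. regular_part ?Z (\<xi> + (of_real t - of_real y)))"
        by (rule continuous_regular_part)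
           (use \<delta>(2)[OF elim(2)] in \<open>auto simp: add_diff_eq intro!: continuous_intros\<close>)
      then have "continuous_on {-1..1} (\<lambda>y. regular_part ?Z (?\<xi> - of_real y) * ?u n y)"
        unfolding add_diff_eq by (intro continuous_on_mult smooth_seq_continuous[OF D])
      then show ?thesis
        unfolding smooth_conv_def by (rule has_pv_integral_continuous[OF _ finite_pole_parameters])
    qed
    ultimately have "has_pv_integral
        (\<lambda>y. (\<Sum>z\<in>?Z. pole_coeff z * (?u n y / of_real (Re (\<xi> - z) + t - y))) +
              regular_part ?Z (?\<xi> - of_real y) * ?u n y) ?P (conv_formula \<xi> D n t) (-1) 1"
      unfolding conv_formula_def by (rule has_pv_integral_add)
    then show ?case
      unfolding has_conv_integral_def
    proof (rule has_pv_integral_spike_finite[OF _ finite_singular_parameters[of ?\<xi>]])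
      fix y :: real
      assume y: "y \<in> {-1..1} - {y \<in> {-1..1}. ?\<xi> - of_real y \<in> singularities}"
      then have an: "k analytic_on {?\<xi> - of_real y}" by simp
      then have np: "\<not> is_pole k (?\<xi> - of_real y)" using pole_imp_singularity by blast
      then have nz: "?\<xi> - of_real y \<notin> ?Z" by (auto simp: poles_at_def)
      have "pole_coeff z * (?u n y / of_real (Re (\<xi> - z) + t - y)) = pole_coeff z / (?\<xi> - of_real y - z) * ?u n y"
        if "z \<in> ?Z" for z
        using poles_at_parameter(1)[OF \<xi> that] by (simp add: algebra_simps)
      then have "(\<Sum>z\<in>?Z. pole_coeff z * (?u n y / of_real (Re (\<xi> - z) + t - y))) =
          (\<Sum>z\<in>?Z. pole_coeff z / (?\<xi> - of_real y - z)) * ?u n y"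
        unfolding sum_distrib_right by (rule sum.cong[OF refl])
      moreover have "regular_part ?Z (?\<xi> - of_real y) =
          k (?\<xi> - of_real y) - (\<Sum>z\<in>?Z. pole_coeff z / (?\<xi> - of_real y - z))"
        using regular_part_eq[OF finite_poles_at _ nz] np an by simp
      ultimately show "(\<Sum>z\<in>?Z. pole_coeff z * (?u n y / of_real (Re (\<xi> - z) + t - y))) +
          regular_part ?Z (?\<xi> - of_real y) * ?u n y = k (?\<xi> - of_real y) * ?u n y"
        by (simp only: left_diff_distrib) simp
    qed
  qed
qed

lemma has_conv_integral_conv_op:
  assumes "regular_point \<xi>" "smooth_seq D"
  shows "has_conv_integral k (D n) \<xi> (conv_op k (D n) \<xi>)"
  using eventually_nhds_x_imp_x[OF has_conv_integral_local[OF assms]] conv_op_eq by simp metis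

lemma has_vector_derivative_smooth_conv:
  assumes D: "smooth_seq D"
  shows "((\<lambda>t. smooth_conv \<xi> (\<lambda>x. D n (of_real x)) t) has_vector_derivative
           smooth_conv \<xi> (\<lambda>x. D (Suc n) (of_real x)) 0
           + regular_part (poles_at \<xi>) (\<xi> + 1) * D n (-1)
           - regular_part (poles_at \<xi>) (\<xi> - 1) * D n 1) (at 0)"
proof -
  let ?h = "regular_part (poles_at \<xi>)" and ?N = "kernel_domain \<xi>" and ?u = "\<lambda>n x. D n (complex_of_real x)"
  obtain \<delta> where \<delta>: "\<delta> > 0"
    "\<And>t y. \<bar>t\<bar> < \<delta> \<Longrightarrow> y \<in> {-1..1} \<Longrightarrow> \<xi> + of_real t - of_real y \<in> ?N"
    using kernel_domain_nhds by blast
  have h: "(?h has_field_derivative deriv ?h w) (at w)" if "w \<in> ?N" for w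
    using that holomorphic_derivI[OF holomorphic_regular_part open_kernel_domain] by blast
  have cont': "continuous_on ?N (deriv ?h)"
    by (intro holomorphic_on_imp_continuous_on holomorphic_deriv holomorphic_regular_part open_kernel_domain)
  have cont: "continuous_on ?N ?h"
    by (intro holomorphic_on_imp_continuous_on holomorphic_regular_part)
  have "((\<lambda>t. integral (cbox (-1) 1) (\<lambda>y. ?h (\<xi> + of_real t - of_real y) * ?u n y)) has_vector_derivative
          integral (cbox (-1) 1) (\<lambda>y. deriv ?h (\<xi> + of_real 0 - of_real y) * ?u n y)) (at 0 within {-\<delta><..<\<delta>})"
  proof (rule leibniz_rule_vector_derivative)
    fix t y :: real assume ty: "t \<in> {-\<delta><..<\<delta>}" "y \<in> cbox (-1) 1"
    then have "\<xi> + of_real t - of_real y \<in> ?N" by (intro \<delta>(2)) auto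
    note h[OF this]
    moreover have "((\<lambda>t. \<xi> + of_real t - of_real y) has_vector_derivative 1) (at t within {-\<delta><..<\<delta>})"
      by (rule derivative_eq_intros refl | simp)+
    ultimately have "((\<lambda>t. ?h (\<xi> + of_real t - of_real y)) has_vector_derivative
        1 * deriv ?h (\<xi> + of_real t - of_real y)) (at t within {-\<delta><..<\<delta>})"
      using field_vector_diff_chain_within[of "\<lambda>t. \<xi> + of_real t - of_real y" 1 t "{-\<delta><..<\<delta>}" ?h]
        has_field_derivative_at_within
      by (fastforce simp: o_def)
    from has_vector_derivative_mult[OF this has_vector_derivative_const[of "?u n y"]]
    show "((\<lambda>t. ?h (\<xi> + of_real t - of_real y) * ?u n y) has_vector_derivative
        deriv ?h (\<xi> + of_real t - of_real y) * ?u n y) (at t within {-\<delta><..<\<delta>})" by simp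
  next
    fix t assume "t \<in> {-\<delta><..<\<delta>}"
    then show "(\<lambda>y. ?h (\<xi> + of_real t - of_real y) * ?u n y) integrable_on cbox (-1) 1"
      unfolding cbox_interval
      by (intro integrable_continuous_real continuous_intros continuous_on_compose2[OF cont]
            smooth_seq_continuous D)
         (auto intro!: \<delta>(2))
  next
    show "continuous_on ({-\<delta><..<\<delta>} \<times> cbox (-1) 1) (\<lambda>(t, y). deriv ?h (\<xi> + of_real t - of_real y) * ?u n y)"
      unfolding split_beta
      by (intro continuous_intros continuous_on_compose2[OF cont']
            continuous_on_compose2[OF smooth_seq_continuous[OF D]])
         (auto intro!: \<delta>(2))
  qed (use \<delta>(1) in auto)
  then have "((\<lambda>t. smooth_conv \<xi> (?u n) t) has_vector_derivative
      integral {-1..1} (\<lambda>y. deriv ?h (\<xi> - of_real y) * ?u n y)) (at 0)"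
    using \<delta>(1) at_within_open[of 0 "{-\<delta><..<\<delta>}"] by (simp add: smooth_conv_def[abs_def])
  moreover have "integral {-1..1} (\<lambda>y. deriv ?h (\<xi> - of_real y) * ?u n y) =
      smooth_conv \<xi> (?u (Suc n)) 0 + ?h (\<xi> + 1) * D n (-1) - ?h (\<xi> - 1) * D n 1"
  proof -
    have in_N: "\<xi> - of_real y \<in> ?N" if "y \<in> {-1..1}" for y
      using \<delta>(2)[of 0 y] \<delta>(1) that by simp
    have "((\<lambda>y. ?h (\<xi> - of_real y) * ?u (Suc n) y - deriv ?h (\<xi> - of_real y) * ?u n y) has_integral
        ?h (\<xi> - of_real 1) * ?u n 1 - ?h (\<xi> - of_real (-1)) * ?u n (-1)) {-1..1}"
    proof (rule fundamental_theorem_of_calculus)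
      fix y :: real assume y: "y \<in> {-1..1}"
      have "((\<lambda>y. \<xi> - of_real y) has_vector_derivative -1) (at y within {-1..1})"
        by (rule derivative_eq_intros refl | simp)+
      from field_vector_diff_chain_within[OF this has_field_derivative_at_within[OF h[OF in_N[OF y]]]]
      have "((\<lambda>y. ?h (\<xi> - of_real y)) has_vector_derivative - deriv ?h (\<xi> - of_real y)) (at y within {-1..1})"
        by (simp add: o_def)
      from has_vector_derivative_mult[OF this smooth_seqD[OF D y, of n]]
      show "((\<lambda>y. ?h (\<xi> - of_real y) * ?u n y) has_vector_derivative
          ?h (\<xi> - of_real y) * ?u (Suc n) y - deriv ?h (\<xi> - of_real y) * ?u n y) (at y within {-1..1})"
        by simp
    qed simp
    moreover have "(\<lambda>y. ?h (\<xi> - of_real y) * ?u (Suc n) y) integrable_on {-1..1}"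
      by (intro integrable_continuous_real continuous_intros continuous_on_compose2[OF cont]
            smooth_seq_continuous D) (use in_N in auto)
    moreover have "(\<lambda>y. deriv ?h (\<xi> - of_real y) * ?u n y) integrable_on {-1..1}"
      by (intro integrable_continuous_real continuous_intros continuous_on_compose2[OF cont']
            smooth_seq_continuous D) (use in_N in auto)
    ultimately show ?thesis
      using integral_diff[of "\<lambda>y. ?h (\<xi> - of_real y) * ?u (Suc n) y" "{-1..1}"
          "\<lambda>y. deriv ?h (\<xi> - of_real y) * ?u n y"]
      by (simp add: integral_unique smooth_conv_def algebra_simps)
  qed
  ultimately show ?thesis by simp
qed

text \<open>
  The derivative of \<open>Ku\<close> is \<open>Ku'\<close> plus boundary terms. These involve the continuous extension
  \<open>remove_sings k\<close>, because \<open>\<xi> + 1\<close> or \<open>\<xi> - 1\<close> may be a removable singularity of \<open>k\<close>.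
\<close>

lemma has_vector_derivative_conv_op:
  assumes \<xi>: "regular_point \<xi>" and D: "smooth_seq D"
  shows "((\<lambda>t. conv_op k (D n) (\<xi> + of_real t)) has_vector_derivative
           conv_op k (D (Suc n)) \<xi> + remove_sings k (\<xi> + 1) * D n (-1) - remove_sings k (\<xi> - 1) * D n 1)
         (at 0)"
proof -
  let ?Z = "poles_at \<xi>" and ?u = "\<lambda>n x. D n (complex_of_real x)"
  let ?x = "\<lambda>z. Re (\<xi> - z)"
  have "(hilbert (?u n) (?u (Suc n)) has_vector_derivative
      hilbert (?u (Suc n)) (?u (Suc (Suc n))) (?x z) + D n 1 / of_real (1 - ?x z) + D n (-1) / of_real (1 + ?x z))
      (at (?x z + 0))" if "z \<in> ?Z" for z
    using has_vector_derivative_hilbert[OF smooth_seqD[OF D] smooth_seqD[OF D] smooth_seq_continuous[OF D]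
        poles_at_parameter(2)[OF \<xi> that], of n]
    by simp
  moreover have "((\<lambda>t. ?x z + t) has_vector_derivative 1) (at 0)" for z
    by (auto intro!: derivative_eq_intros simp flip: has_real_derivative_iff_has_vector_derivative)
  ultimately have "((\<lambda>t. hilbert (?u n) (?u (Suc n)) (?x z + t)) has_vector_derivative
      hilbert (?u (Suc n)) (?u (Suc (Suc n))) (?x z) + D n 1 / of_real (1 - ?x z) + D n (-1) / of_real (1 + ?x z))
      (at 0)" if "z \<in> ?Z" for z
    using vector_diff_chain_at[of "\<lambda>t. ?x z + t" 1 0 "hilbert (?u n) (?u (Suc n))"] that
    by (simp add: o_def)
  note hil = has_vector_derivative_mult_right[OF this]
  have "((\<lambda>t. conv_formula \<xi> D n t) has_vector_derivative
      (\<Sum>z\<in>?Z. pole_coeff z * (hilbert (?u (Suc n)) (?u (Suc (Suc n))) (?x z) +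
           D n 1 / of_real (1 - ?x z) + D n (-1) / of_real (1 + ?x z))) +
      (smooth_conv \<xi> (?u (Suc n)) 0 + regular_part ?Z (\<xi> + 1) * D n (-1) - regular_part ?Z (\<xi> - 1) * D n 1)) (at 0)"
    unfolding conv_formula_def
    by (intro has_vector_derivative_add has_vector_derivative_sum hil has_vector_derivative_smooth_conv D)
  also have "(\<Sum>z\<in>?Z. pole_coeff z * (hilbert (?u (Suc n)) (?u (Suc (Suc n))) (?x z) +
           D n 1 / of_real (1 - ?x z) + D n (-1) / of_real (1 + ?x z))) +
      (smooth_conv \<xi> (?u (Suc n)) 0 + regular_part ?Z (\<xi> + 1) * D n (-1) - regular_part ?Z (\<xi> - 1) * D n 1) =
      conv_formula \<xi> D (Suc n) 0 + remove_sings k (\<xi> + 1) * D n (-1) - remove_sings k (\<xi> - 1) * D n 1"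
  proof -
    have end_ok: "\<not> is_pole k (\<xi> + 1)" "\<not> is_pole k (\<xi> - 1)" "\<xi> + 1 \<notin> ?Z" "\<xi> - 1 \<notin> ?Z"
      using \<xi> by (force simp: regular_point_def poles_at_def)+
    have alg: "c * (H + p / - v + q / w) = c * H + (c / w * q - c / v * p)" for c H p q v w :: complex
      by (simp add: distrib_left right_diff_distrib)
    have "of_real (1 + ?x z) = \<xi> + 1 - z" "of_real (1 - ?x z) = - (\<xi> - 1 - z)" if "z \<in> ?Z" for z
      using poles_at_parameter(1)[OF \<xi> that] by (simp_all add: algebra_simps)
    then have "(\<Sum>z\<in>?Z. pole_coeff z * (hilbert (?u (Suc n)) (?u (Suc (Suc n))) (?x z) +
           D n 1 / of_real (1 - ?x z) + D n (-1) / of_real (1 + ?x z))) =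
        (\<Sum>z\<in>?Z. pole_coeff z * hilbert (?u (Suc n)) (?u (Suc (Suc n))) (?x z)
           + (pole_coeff z / (\<xi> + 1 - z) * D n (-1) - pole_coeff z / (\<xi> - 1 - z) * D n 1))"
      by (intro sum.cong refl) (simp only: alg)
    also have "\<dots> = (\<Sum>z\<in>?Z. pole_coeff z * hilbert (?u (Suc n)) (?u (Suc (Suc n))) (?x z))
        + (\<Sum>z\<in>?Z. pole_coeff z / (\<xi> + 1 - z)) * D n (-1) - (\<Sum>z\<in>?Z. pole_coeff z / (\<xi> - 1 - z)) * D n 1"
      by (simp add: sum.distrib sum_subtractf sum_distrib_right)
    finally show ?thesis
      using end_ok
      by (simp add: conv_formula_def regular_part_eq finite_poles_at algebra_simps)
  qed
  also have "conv_formula \<xi> D (Suc n) 0 = conv_op k (D (Suc n)) \<xi>"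
    using conv_op_eq[OF eventually_nhds_x_imp_x[OF has_conv_integral_local[OF \<xi> D]]] by simp
  finally have *: "(conv_formula \<xi> D n has_vector_derivative
      conv_op k (D (Suc n)) \<xi> + remove_sings k (\<xi> + 1) * D n (-1) - remove_sings k (\<xi> - 1) * D n 1) (at 0)" .
  have ev: "\<forall>\<^sub>F t in nhds 0. conv_op k (D n) (\<xi> + of_real t) = conv_formula \<xi> D n t"
    using has_conv_integral_local[OF \<xi> D] by eventually_elim (rule conv_op_eq)
  show ?thesis
    using * ev eventually_nhds_x_imp_x[OF ev]
      has_vector_derivative_cong_ev[where S = UNIV and x = 0 and f = "\<lambda>t. conv_op k (D n) (\<xi> + of_real t)" and g = "conv_formula \<xi> D n"]
    by simp
qed

end

section \<open>Derivatives within horizontal segments\<close>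

lemma at_within_open_segment_neq_bot:
  fixes a b :: complex
  assumes "\<xi> \<in> open_segment a b"
  shows "at \<xi> within open_segment a b \<noteq> bot"
proof -
  have "a \<noteq> b" using assms by auto
  then have "infinite (open_segment a b)" by simp
  then have "open_segment a b \<noteq> {\<xi>}" by (metis finite.emptyI finite_insert)
  then have "\<xi> islimpt open_segment a b"
    using assms by (intro connected_imp_perfect) (auto simp: convex_connected)
  then show ?thesis using trivial_limit_within by blast
qed

lemma deriv_within_eq:
  assumes "(f has_field_derivative D) (at x within S)" "at x within S \<noteq> bot"
  shows "deriv_within S f x = D"
proof -
  have "(f has_field_derivative deriv_within S f x) (at x within S)"
    unfolding deriv_within_def using assms(1) by (rule someI)
  with assms show ?thesis
    unfolding has_field_derivative_iff using tendsto_unique by blast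
qed

lemma Im_open_segment_horizontal:
  assumes "Im a = Im b" "\<xi> \<in> open_segment a b"
  shows "Im \<xi> = Im a"
proof -
  obtain u where u: "\<xi> = (1 - u) *\<^sub>R a + u *\<^sub>R b"
    using assms(2) by (auto simp: in_segment)
  have "Im \<xi> = (1 - u) * Im a + u * Im b" by (simp add: u)
  with assms(1) show ?thesis by (simp add: algebra_simps)
qed

text \<open>Differentiation along a horizontal line is differentiation in a real parameter.\<close>

lemma has_field_derivative_horizontal:
  assumes f: "((\<lambda>t. f (\<xi> + of_real t)) has_vector_derivative D) (at 0)"
    and S: "\<And>w. w \<in> S \<Longrightarrow> Im w = Im \<xi>"
  shows "(f has_field_derivative D) (at \<xi> within S)"
proof -
  let ?g = "\<lambda>t. (f (\<xi> + of_real t) - f \<xi>) / of_real t"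
  have "(\<lambda>t. norm (f (\<xi> + of_real t) - f \<xi> - t *\<^sub>R D) / norm t) \<midarrow>0\<rightarrow> 0"
    using f by (simp add: has_vector_derivative_def has_derivative_at)
  moreover have "norm (f (\<xi> + of_real t) - f \<xi> - t *\<^sub>R D) / norm t = norm (?g t - D)" if "t \<noteq> 0" for t
  proof -
    have "?g t - D = (f (\<xi> + of_real t) - f \<xi> - t *\<^sub>R D) / of_real t"
      using that by (simp add: field_simps scaleR_conv_of_real)
    then show ?thesis by (simp add: norm_divide)
  qed
  ultimately have "(\<lambda>t. norm (?g t - D)) \<midarrow>0\<rightarrow> 0"
    by (elim Lim_transform_eventually) (simp add: eventually_at_filter)
  then have "?g \<midarrow>0\<rightarrow> D"
    by (rule LIM_zero_cancel[OF tendsto_norm_zero_cancel])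
  moreover have "filterlim (\<lambda>w. Re w - Re \<xi>) (at 0) (at \<xi> within S)"
    unfolding filterlim_at
  proof
    show "\<forall>\<^sub>F w in at \<xi> within S. Re w - Re \<xi> \<in> UNIV \<and> Re w - Re \<xi> \<noteq> 0"
      unfolding eventually_at_filter by (intro always_eventually) (use S in \<open>auto simp: complex_eq_iff\<close>)
    have "((\<lambda>w. Re w - Re \<xi>) \<longlongrightarrow> Re \<xi> - Re \<xi>) (at \<xi> within S)"
      by (intro tendsto_intros)
    then show "((\<lambda>w. Re w - Re \<xi>) \<longlongrightarrow> 0) (at \<xi> within S)" by simp
  qed
  ultimately have "((\<lambda>w. ?g (Re w - Re \<xi>)) \<longlongrightarrow> D) (at \<xi> within S)"
    by (rule filterlim_compose)
  moreover have "\<forall>\<^sub>F w in at \<xi> within S. ?g (Re w - Re \<xi>) = (f w - f \<xi>) / (w - \<xi>)"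
  proof -
    have "of_real (Re w - Re \<xi>) = w - \<xi>" if "w \<in> S" for w
      using S[OF that] by (simp add: complex_eq_iff)
    then have "?g (Re w - Re \<xi>) = (f w - f \<xi>) / (w - \<xi>)" if "w \<in> S" for w
      using that by simp
    then show ?thesis by (simp add: eventually_at_filter)
  qed
  ultimately show ?thesis
    unfolding has_field_derivative_iff by (rule Lim_transform_eventually)
qed

lemma smooth_within_imp_smooth_seq:
  assumes "smooth_within (closed_segment (-1) 1) u"
  obtains D where "smooth_seq D" "D 0 = u"
proof -
  let ?S = "closed_segment (-1) (1::complex)"
  obtain D where D0: "\<And>x. x \<in> ?S \<Longrightarrow> D 0 x = u x"
    and D: "\<And>n x. x \<in> ?S \<Longrightarrow> (D n has_field_derivative D (Suc n) x) (at x within ?S)"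
    using assms unfolding smooth_within_def by blast
  have "((D(0 := u)) n has_field_derivative (D(0 := u)) (Suc n) x) (at x within ?S)" if "x \<in> ?S" for n x
  proof (cases n)
    case 0
    have "(u has_field_derivative D (Suc 0) x) (at x within ?S)"
      using D[OF that, of 0]
      by (rule has_field_derivative_transform_within[where d = 1]) (use that D0 in auto)
    with 0 show ?thesis by simp
  qed (use D[OF that] in simp)
  then have "smooth_seq (D(0 := u))" by (simp add: smooth_seq_def)
  then show thesis by (rule that) simp
qed

lemma diff_op_eq:
  assumes "smooth_seq D" "x \<in> open_segment (-1) 1"
  shows "diff_op (open_segment (-1) 1) (A, B, C) (D 0) x = A x * D 2 x + B x * D 1 x + C x * D 0 x"
proof -
  let ?T = "open_segment (-1) (1::complex)"
  have D: "(D n has_field_derivative D (Suc n) x) (at x within ?T)" if "x \<in> ?T" for n x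
    using assms(1) that has_field_derivative_subset[OF _ segment_open_subset_closed]
    unfolding smooth_seq_def by (meson segment_open_subset_closed subsetD)
  have 1: "deriv_within ?T (D 0) x = D 1 x" if "x \<in> ?T" for x
    using deriv_within_eq[OF D[OF that, of 0]] at_within_open_segment_neq_bot[OF that] by simp
  have "(deriv_within ?T (D 0) has_field_derivative D 2 x) (at x within ?T)"
    by (rule has_field_derivative_transform_within[of "D 1" _ _ _ 1])
       (use assms(2) D[OF assms(2), of 1] 1 in \<open>auto simp: numeral_2_eq_2\<close>)
  then have "deriv_within ?T (deriv_within ?T (D 0)) x = D 2 x"
    by (rule deriv_within_eq) (rule at_within_open_segment_neq_bot[OF assms(2)])
  with 1[OF assms(2)] show ?thesis by simp
qed

section \<open>A criterion for the intertwining relation\<close>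

context simple_pole_kernel
begin

lemma has_field_derivative_conv_op:
  assumes "Im a = Im b" "\<xi> \<in> open_segment a b" "regular_point \<xi>" "smooth_seq D"
  shows "(conv_op k (D n) has_field_derivative
           conv_op k (D (Suc n)) \<xi> + remove_sings k (\<xi> + 1) * D n (-1) - remove_sings k (\<xi> - 1) * D n 1)
         (at \<xi> within open_segment a b)"
proof (rule has_field_derivative_horizontal[where f = "conv_op k (D n)"])
  show "Im w = Im \<xi>" if "w \<in> open_segment a b" for w
    using Im_open_segment_horizontal[OF assms(1)] assms(2) that by simp
qed (rule has_vector_derivative_conv_op[OF assms(3,4)])

lemma has_field_derivative_remove_sings:
  assumes "\<not> is_pole k w"
  shows "(remove_sings k has_field_derivative deriv (remove_sings k) w) (at w)"
proof -
  have "remove_sings k field_differentiable (at w)"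
    by (rule analytic_on_imp_differentiable_at[OF analytic_remove_sings[OF assms]]) simp
  then show ?thesis by (simp only: DERIV_deriv_iff_field_differentiable)
qed

text \<open>
  The core of the argument. Under the hypotheses, the difference between \<open>KLu\<close> and the expression
  \<open>A(\<xi>) Ku'' + B(\<xi>) Ku' + C(\<xi>) Ku\<close> is the integral of a total derivative \<open>(P u' + W u)'\<close> without
  singularities, hence a boundary term.
\<close>

lemma has_conv_integral_diff_op:
  assumes \<xi>: "regular_point \<xi>" and D: "smooth_seq D"
    and P: "\<And>y. (P has_field_derivative P' y) (at y)"
    and W: "\<And>y. (W has_field_derivative W' y) (at y)"
    and A: "\<And>y. \<not> is_pole k (\<xi> - y) \<Longrightarrow> remove_sings k (\<xi> - y) * (A \<xi> - A y) = P y"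
    and B: "\<And>y. \<not> is_pole k (\<xi> - y) \<Longrightarrow> remove_sings k (\<xi> - y) * (B \<xi> - B y) = W y + P' y"
    and C: "\<And>y. \<not> is_pole k (\<xi> - y) \<Longrightarrow> remove_sings k (\<xi> - y) * (C \<xi> - C y) = W' y"
  shows "has_conv_integral k (diff_op (open_segment (-1) 1) (A, B, C) (D 0)) \<xi>
    (A \<xi> * conv_op k (D 2) \<xi> + B \<xi> * conv_op k (D 1) \<xi> + C \<xi> * conv_op k (D 0) \<xi>
      - (P 1 * D 1 1 + W 1 * D 0 1 - (P (-1) * D 1 (-1) + W (-1) * D 0 (-1))))"
proof -
  let ?u = "\<lambda>n y. D n (complex_of_real y)"
  let ?P = "{y \<in> {-1..1}. is_pole k (\<xi> - of_real y)}"
  define \<Phi> where "\<Phi> y = P (of_real y) * ?u 1 y + W (of_real y) * ?u 0 y" for y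
  define \<phi> where "\<phi> y = P (of_real y) * ?u 2 y + (P' (of_real y) + W (of_real y)) * ?u 1 y
      + W' (of_real y) * ?u 0 y" for y

  have contP: "continuous_on {-1..1} (\<lambda>y::real. f (of_real y))"
    if "\<And>y. (f has_field_derivative f' y) (at y)" for f f' :: "complex \<Rightarrow> complex"
  proof -
    have "continuous_on UNIV f"
      using that by (auto intro!: DERIV_continuous simp: continuous_on_eq_continuous_at)
    then show ?thesis by (rule continuous_on_compose2) (auto intro!: continuous_intros)
  qed
  have contP': "continuous_on {-1..1} (\<lambda>y::real. f' (of_real y))"
    if "\<And>y. (f has_field_derivative f' y) (at y)" for f f' :: "complex \<Rightarrow> complex"
  proof -
    have "f' = deriv f" by (intro ext) (simp add: DERIV_imp_deriv[OF that])
    moreover have "f holomorphic_on UNIV" using that by (auto simp: holomorphic_on_open)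
    ultimately have "f' holomorphic_on UNIV" by (simp add: holomorphic_deriv)
    then have "continuous_on UNIV f'" by (rule holomorphic_on_imp_continuous_on)
    then show ?thesis by (rule continuous_on_compose2) (auto intro!: continuous_intros)
  qed
  have real: "((\<lambda>y. f (of_real y)) has_vector_derivative f' (of_real y)) (at y within {-1..1})"
    if "\<And>y. (f has_field_derivative f' y) (at y)" for f f' :: "complex \<Rightarrow> complex" and y :: real
    by (rule has_vector_derivative_real_field) (rule that)
  have "(\<Phi> has_vector_derivative \<phi> y) (at y within {-1..1})" if y: "y \<in> {-1..1}" for y
  proof -
    have "(\<Phi> has_vector_derivative
        (P (of_real y) * ?u (Suc 1) y + P' (of_real y) * ?u 1 y) +
        (W (of_real y) * ?u (Suc 0) y + W' (of_real y) * ?u 0 y)) (at y within {-1..1})"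
      unfolding \<Phi>_def[abs_def]
      by (intro has_vector_derivative_add has_vector_derivative_mult real P W smooth_seqD[OF D y])
    then show ?thesis by (simp add: \<phi>_def numeral_2_eq_2 algebra_simps)
  qed
  then have "(\<phi> has_integral \<Phi> 1 - \<Phi> (-1)) {-1..1}"
    by (intro fundamental_theorem_of_calculus) auto
  then have "integral {-1..1} \<phi> = \<Phi> 1 - \<Phi> (-1)" by (rule integral_unique)
  moreover have "continuous_on {-1..1} \<phi>"
    unfolding \<phi>_def[abs_def]
    by (intro continuous_on_add continuous_on_mult contP[OF P] contP[OF W] contP'[OF P] contP'[OF W]
          smooth_seq_continuous[OF D])
  ultimately have pv: "has_pv_integral \<phi> ?P (\<Phi> 1 - \<Phi> (-1)) (-1) 1"
    using has_pv_integral_continuous[OF _ finite_pole_parameters] by metis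

  have K: "has_pv_integral (\<lambda>y. k (\<xi> - of_real y) * ?u n y) ?P (conv_op k (D n) \<xi>) (-1) 1" for n
    using has_conv_integral_conv_op[OF \<xi> D, of n] unfolding has_conv_integral_def .
  have "has_pv_integral (\<lambda>y.
      A \<xi> * (k (\<xi> - of_real y) * ?u 2 y) + B \<xi> * (k (\<xi> - of_real y) * ?u 1 y)
        + C \<xi> * (k (\<xi> - of_real y) * ?u 0 y) + (-1) * \<phi> y) ?P
      (A \<xi> * conv_op k (D 2) \<xi> + B \<xi> * conv_op k (D 1) \<xi> + C \<xi> * conv_op k (D 0) \<xi>
        + (-1) * (\<Phi> 1 - \<Phi> (-1))) (-1) 1"
    by (intro has_pv_integral_add has_pv_integral_cmul K pv)
  then have "has_pv_integral (\<lambda>y. k (\<xi> - of_real y) *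
        diff_op (open_segment (-1) 1) (A, B, C) (D 0) (of_real y)) ?P
      (A \<xi> * conv_op k (D 2) \<xi> + B \<xi> * conv_op k (D 1) \<xi> + C \<xi> * conv_op k (D 0) \<xi>
        + (-1) * (\<Phi> 1 - \<Phi> (-1))) (-1) 1"
  proof (rule has_pv_integral_spike_finite)
    show "finite ({y \<in> {-1..1}. \<xi> - of_real y \<in> singularities} \<union> {-1, 1})"
      using finite_singular_parameters by simp
    fix y :: real
    assume y: "y \<in> {-1..1} - ({y \<in> {-1..1}. \<xi> - of_real y \<in> singularities} \<union> {-1, 1})"
    then have an: "k analytic_on {\<xi> - of_real y}" by auto
    then have np: "\<not> is_pole k (\<xi> - of_real y)" using pole_imp_singularity by blast
    have k: "remove_sings k (\<xi> - of_real y) = k (\<xi> - of_real y)" using an by simp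
    have "complex_of_real y \<in> open_segment (-1) 1"
      using y unfolding open_segment_def closed_segment_complex_unit by (auto simp: complex_eq_iff)
    note L = diff_op_eq[OF D this, of A B C]
    have "\<phi> y = k (\<xi> - of_real y) * (A \<xi> - A (of_real y)) * ?u 2 y
        + k (\<xi> - of_real y) * (B \<xi> - B (of_real y)) * ?u 1 y
        + k (\<xi> - of_real y) * (C \<xi> - C (of_real y)) * ?u 0 y"
      using A[OF np] B[OF np] C[OF np] by (simp add: \<phi>_def k add.commute)
    then show "A \<xi> * (k (\<xi> - of_real y) * ?u 2 y) + B \<xi> * (k (\<xi> - of_real y) * ?u 1 y)
        + C \<xi> * (k (\<xi> - of_real y) * ?u 0 y) + (-1) * \<phi> y =
        k (\<xi> - of_real y) * diff_op (open_segment (-1) 1) (A, B, C) (D 0) (of_real y)"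
      unfolding L by (simp add: algebra_simps)
  qed
  then show ?thesis
    unfolding has_conv_integral_def by (simp add: \<Phi>_def algebra_simps)
qed

text \<open>
  At an end point \<open>e\<close> with \<open>A e = 0\<close> and \<open>A' e = B e\<close>, the boundary terms of the previous lemma are the
  ones that differentiating \<open>Ku\<close> produces.
\<close>

lemma boundary_values:
  assumes e: "\<not> is_pole k (\<xi> - e)"
    and P: "\<And>y. (P has_field_derivative P' y) (at y)"
    and A: "\<And>y. \<not> is_pole k (\<xi> - y) \<Longrightarrow> remove_sings k (\<xi> - y) * (A \<xi> - A y) = P y"
    and B: "\<And>y. \<not> is_pole k (\<xi> - y) \<Longrightarrow> remove_sings k (\<xi> - y) * (B \<xi> - B y) = W y + P' y"
    and Ae: "A e = 0" "(A has_field_derivative B e) (at e)"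
  shows "P e = remove_sings k (\<xi> - e) * A \<xi>"
    and "W e = remove_sings k (\<xi> - e) * B \<xi> + deriv (remove_sings k) (\<xi> - e) * A \<xi>"
proof -
  let ?k = "remove_sings k"
  show "P e = ?k (\<xi> - e) * A \<xi>" using A[OF e] Ae by simp
  have "((\<lambda>y. ?k (\<xi> - y)) has_field_derivative deriv ?k (\<xi> - e) * (-1)) (at e)"
    by (rule DERIV_chain2[where f = ?k and g = "\<lambda>y. \<xi> - y", OF has_field_derivative_remove_sings[OF e]]) (auto intro!: derivative_eq_intros)
  then have "((\<lambda>y. ?k (\<xi> - y) * (A \<xi> - A y)) has_field_derivative
      - deriv ?k (\<xi> - e) * (A \<xi> - A e) - ?k (\<xi> - e) * B e) (at e)"
    by (auto intro!: derivative_eq_intros Ae(2))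
  then have "(P has_field_derivative - deriv ?k (\<xi> - e) * (A \<xi> - A e) - ?k (\<xi> - e) * B e) (at e)"
  proof (rule has_field_derivative_transform_within_open)
    have "{y. \<not> is_pole k (\<xi> - y)} = (\<lambda>y. \<xi> - y) -` (- poles)" by auto
    then show "open {y. \<not> is_pole k (\<xi> - y)}"
      by (simp only:) (intro continuous_open_vimage continuous_intros open_Compl closed_poles order_refl)
  qed (use e A in auto)
  then have "P' e = - deriv ?k (\<xi> - e) * A \<xi> - ?k (\<xi> - e) * B e"
    using DERIV_unique[OF P] Ae(1) by simp
  with B[OF e] show "W e = ?k (\<xi> - e) * B \<xi> + deriv ?k (\<xi> - e) * A \<xi>"
    by (simp add: algebra_simps)
qed

text \<open>
  The criterion. Cancellation of the poles of \<open>k\<close> against the zeros of the coefficient differences is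
  expressed by the existence of the entire functions \<open>P\<close> and \<open>W\<close>.
\<close>

lemma intertwinesI:
  assumes ab: "Im a = Im b"
    and A1: "A 1 = 0" "(A has_field_derivative B 1) (at 1)"
    and A2: "A (-1) = 0" "(A has_field_derivative B (-1)) (at (-1))"
    and PW: "\<And>\<xi>. \<xi> \<in> open_segment a b \<Longrightarrow> \<exists>P P' W W'.
      (\<forall>y. (P has_field_derivative P' y) (at y)) \<and> (\<forall>y. (W has_field_derivative W' y) (at y)) \<and>
      (\<forall>y. \<not> is_pole k (\<xi> - y) \<longrightarrow>
         remove_sings k (\<xi> - y) * (A \<xi> - A y) = P y \<and>
         remove_sings k (\<xi> - y) * (B \<xi> - B y) = W y + P' y \<and>
         remove_sings k (\<xi> - y) * (C \<xi> - C y) = W' y)"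
  shows "intertwines k (A, B, C) a b"
  unfolding intertwines_def
proof (intro allI impI ballI)
  fix u \<xi>
  assume u: "smooth_within (closed_segment (-1) 1) u" and \<xi>: "\<xi> \<in> open_segment a b"
    and "\<forall>z. is_pole k z \<longrightarrow> \<xi> \<noteq> z + 1 \<and> \<xi> \<noteq> z - 1"
  then have reg: "regular_point \<xi>" by (simp add: regular_point_def)
  obtain D where D: "smooth_seq D" "D 0 = u"
    using smooth_within_imp_smooth_seq[OF u] .
  let ?S = "open_segment a b" and ?k = "remove_sings k"
  obtain P P' W W' where P: "\<And>y. (P has_field_derivative P' y) (at y)"
    and W: "\<And>y. (W has_field_derivative W' y) (at y)"
    and A: "\<And>y. \<not> is_pole k (\<xi> - y) \<Longrightarrow> ?k (\<xi> - y) * (A \<xi> - A y) = P y"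
    and B: "\<And>y. \<not> is_pole k (\<xi> - y) \<Longrightarrow> ?k (\<xi> - y) * (B \<xi> - B y) = W y + P' y"
    and C: "\<And>y. \<not> is_pole k (\<xi> - y) \<Longrightarrow> ?k (\<xi> - y) * (C \<xi> - C y) = W' y"
    using PW[OF \<xi>] by metis
  have np: "\<not> is_pole k (\<xi> - 1)" "\<not> is_pole k (\<xi> - (-1))"
    using reg by (force simp: regular_point_def)+
  let ?I = "A \<xi> * conv_op k (D 2) \<xi> + B \<xi> * conv_op k (D 1) \<xi> + C \<xi> * conv_op k (D 0) \<xi>
      - (P 1 * D 1 1 + W 1 * D 0 1 - (P (-1) * D 1 (-1) + W (-1) * D 0 (-1)))"
  have KL: "has_conv_integral k (diff_op (open_segment (-1) 1) (A, B, C) u) \<xi> ?I"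
    using has_conv_integral_diff_op[OF reg D(1) P W A B C] D(2) by simp

  define G where "G \<eta> = conv_op k (D 1) \<eta> + ?k (\<eta> + 1) * D 0 (-1) - ?k (\<eta> - 1) * D 0 1" for \<eta>
  have dK: "(conv_op k u has_field_derivative G \<eta>) (at \<eta> within ?S)"
    if "\<eta> \<in> ?S" "regular_point \<eta>" for \<eta>
    using has_field_derivative_conv_op[OF ab that D(1), of 0] D(2) by (simp add: G_def)
  have dK_eq: "deriv_within ?S (conv_op k u) \<eta> = G \<eta>" if "\<eta> \<in> ?S" "regular_point \<eta>" for \<eta>
    by (rule deriv_within_eq[OF dK[OF that] at_within_open_segment_neq_bot[OF that(1)]])
  let ?G' = "conv_op k (D 2) \<xi> + ?k (\<xi> + 1) * D 1 (-1) - ?k (\<xi> - 1) * D 1 1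
      + deriv ?k (\<xi> + 1) * D 0 (-1) - deriv ?k (\<xi> - 1) * D 0 1"
  have shift: "((\<lambda>\<eta>. ?k (\<eta> + c)) has_field_derivative deriv ?k (\<xi> + c) * 1) (at \<xi> within ?S)"
    if "\<not> is_pole k (\<xi> + c)" for c
    by (rule DERIV_chain2[where f = ?k and g = "\<lambda>\<eta>. \<eta> + c", OF has_field_derivative_remove_sings[OF that]])
       (auto intro!: derivative_eq_intros)
  have "((\<lambda>\<eta>. ?k (\<eta> + 1)) has_field_derivative deriv ?k (\<xi> + 1)) (at \<xi> within ?S)"
    "((\<lambda>\<eta>. ?k (\<eta> - 1)) has_field_derivative deriv ?k (\<xi> - 1)) (at \<xi> within ?S)"
    using shift[of 1] shift[of "-1"] np by simp_all
  then have dG: "(G has_field_derivative ?G') (at \<xi> within ?S)"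
    using has_field_derivative_conv_op[OF ab \<xi> reg D(1), of 1] unfolding G_def[abs_def]
    by (auto intro!: derivative_eq_intros simp: numeral_2_eq_2)
  obtain d where d: "d > 0" "\<And>\<eta>. dist \<eta> \<xi> < d \<Longrightarrow> regular_point \<eta>"
    using open_regular_points reg unfolding open_dist by blast
  have ddK: "(deriv_within ?S (conv_op k u) has_field_derivative ?G') (at \<xi> within ?S)"
    by (rule has_field_derivative_transform_within[OF dG d(1) \<xi>]) (use dK_eq d(2) in auto)
  have ddK_eq: "deriv_within ?S (deriv_within ?S (conv_op k u)) \<xi> = ?G'"
    by (rule deriv_within_eq[OF ddK at_within_open_segment_neq_bot[OF \<xi>]])

  \<comment> \<open>The boundary terms of the integral of the total derivative cancel those of \<open>LKu\<close>.\<close>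
  have "?I = A \<xi> * ?G' + B \<xi> * G \<xi> + C \<xi> * conv_op k u \<xi>"
    using boundary_values[OF np(1) P A B A1] boundary_values[OF np(2) P A B A2] D(2)
    by (simp add: G_def algebra_simps)
  then have "conv_op k (diff_op (open_segment (-1) 1) (A, B, C) u) \<xi> = diff_op ?S (A, B, C) (conv_op k u) \<xi>"
    using conv_op_eq[OF KL] dK_eq[OF \<xi> reg] ddK_eq by simp
  moreover have "has_conv_integral k u \<xi> (conv_op k u \<xi>)"
    using has_conv_integral_conv_op[OF reg D(1), of 0] D(2) by simp
  ultimately show "(\<exists>I. has_conv_integral k u \<xi> I) \<and>
          (\<exists>I. has_conv_integral k (diff_op (open_segment (-1) 1) (A, B, C) u) \<xi> I) \<and>
          conv_op k u field_differentiable (at \<xi> within ?S) \<and>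
          deriv_within ?S (conv_op k u) field_differentiable (at \<xi> within ?S) \<and>
          conv_op k (diff_op (open_segment (-1) 1) (A, B, C) u) \<xi> = diff_op ?S (A, B, C) (conv_op k u) \<xi>"
    using KL dK[OF \<xi> reg] ddK by (auto simp: field_differentiable_def)
qed

end

text \<open>
  A quotient \<open>F / s\<close> of entire functions, where \<open>s\<close> has only simple zeros, has at most simple poles.
  Away from the poles its continuous extension satisfies \<open>k s = F\<close>, also at common zeros of \<open>F\<close> and \<open>s\<close>.
\<close>

lemma quotient_kernel:
  assumes F: "F holomorphic_on UNIV" and s: "s holomorphic_on UNIV"
    and simple: "\<And>z. s z = 0 \<Longrightarrow> deriv s z \<noteq> 0"
    and k: "\<And>z. s z \<noteq> 0 \<Longrightarrow> k z = F z / s z"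
  shows simple_pole_kernel_quotient: "simple_pole_kernel k"
    and remove_sings_quotient: "\<not> is_pole k z \<Longrightarrow> remove_sings k z * s z = F z"
proof -
  have isCont: "isCont f z" if "f holomorphic_on UNIV" for f :: "complex \<Rightarrow> complex" and z
    using holomorphic_on_imp_continuous_on[OF that] by (simp add: continuous_on_eq_continuous_at)
  have *: "(\<exists>r g. g analytic_on {z} \<and> (\<forall>\<^sub>F w in at z. k w = r / (w - z) + g w)) \<and>
      (\<forall>\<^sub>F w in at z. s w \<noteq> 0)" for z
  proof (cases "s z = 0")
    case False
    let ?U = "{w. s w \<noteq> 0}"
    have "open ?U"
      using holomorphic_on_imp_continuous_on[OF s] by (intro open_Collect_neq) auto
    have ev: "\<forall>\<^sub>F w in at z. s w \<noteq> 0"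
      using eventually_at_in_open'[OF \<open>open ?U\<close>, of z] False by simp
    have "(\<lambda>w. F w / s w) holomorphic_on ?U"
      using F s by (intro holomorphic_intros) (auto intro: holomorphic_on_subset)
    then have "(\<lambda>w. F w / s w) analytic_on {z}"
      using \<open>open ?U\<close> False by (auto simp: analytic_at)
    moreover have "\<forall>\<^sub>F w in at z. k w = 0 / (w - z) + F w / s w"
      using ev by eventually_elim (simp add: k)
    ultimately show ?thesis using ev by blast
  next
    case True
    define \<sigma> where "\<sigma> = (\<lambda>w. if w = z then deriv s z else (s w - s z) / (w - z))"
    have \<sigma>: "\<sigma> holomorphic_on UNIV"
      unfolding \<sigma>_def by (rule pole_lemma_open[OF s]) simp
    let ?U = "{w. \<sigma> w \<noteq> 0}"
    have "open ?U"
      using holomorphic_on_imp_continuous_on[OF \<sigma>] by (intro open_Collect_neq) auto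
    have z: "z \<in> ?U" using simple[OF True] by (simp add: \<sigma>_def)
    define f where "f w = F w / \<sigma> w" for w
    have f: "f holomorphic_on ?U"
      unfolding f_def[abs_def] using F \<sigma> by (intro holomorphic_intros) (auto intro: holomorphic_on_subset)
    define g where "g = (\<lambda>w. if w = z then deriv f z else (f w - f z) / (w - z))"
    have "g holomorphic_on ?U"
      unfolding g_def by (rule pole_lemma_open[OF f \<open>open ?U\<close>])
    then have "g analytic_on {z}"
      using \<open>open ?U\<close> z by (auto simp: analytic_at)
    have s_eq: "s w = (w - z) * \<sigma> w" if "w \<noteq> z" for w
      using that True by (simp add: \<sigma>_def)
    have evU: "\<forall>\<^sub>F w in at z. w \<in> ?U - {z}"
      by (rule eventually_at_in_open[OF \<open>open ?U\<close> z])
    then have ev: "\<forall>\<^sub>F w in at z. s w \<noteq> 0"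
      by eventually_elim (simp add: s_eq)
    have "\<forall>\<^sub>F w in at z. k w = f z / (w - z) + g w"
      using evU
    proof eventually_elim
      case (elim w)
      then have "k w = f w / (w - z)" using k[of w] by (simp add: s_eq f_def mult.commute)
      with elim show ?case by (simp add: g_def flip: add_divide_distrib)
    qed
    with \<open>g analytic_on {z}\<close> ev show ?thesis by blast
  qed
  then show kernel: "simple_pole_kernel k" by unfold_locales blast
  assume np: "\<not> is_pole k z"
  have "\<forall>\<^sub>F w in at z. remove_sings k w = k w"
    by (intro eventually_remove_sings_eq_at simple_pole_kernel.isolated_singularity kernel)
  moreover have "\<forall>\<^sub>F w in at z. s w \<noteq> 0" using * by blast
  ultimately have "\<forall>\<^sub>F w in at z. remove_sings k w * s w = F w"
    by eventually_elim (simp add: k)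
  moreover have "(\<lambda>w. remove_sings k w * s w) \<midarrow>z\<rightarrow> remove_sings k z * s z"
    using analytic_at_imp_isCont[OF simple_pole_kernel.analytic_remove_sings[OF kernel np]] isCont[OF s, of z]
    by (auto simp: isCont_def intro!: tendsto_intros)
  ultimately have "F \<midarrow>z\<rightarrow> remove_sings k z * s z"
    by (rule Lim_transform_eventually[rotated])
  moreover have "F \<midarrow>z\<rightarrow> F z" using isCont[OF F] by (simp add: isCont_def)
  ultimately show "remove_sings k z * s z = F z" by (rule LIM_unique)
qed

text \<open>
  For such a kernel the criterion becomes algebraic. If the coefficient differences
  are \<open>s (\<xi> - y)\<close> times entire functions \<open>A\<^sub>1\<close>, \<open>B\<^sub>1\<close>, \<open>C\<^sub>1\<close>, then the conditions amount to
  \<open>\<partial>\<^sub>y \<partial>\<^sub>y (F A\<^sub>1) - \<partial>\<^sub>y (F B\<^sub>1) + F C\<^sub>1 = 0\<close>, with \<open>F\<close> taken at \<open>\<xi> - y\<close>; here \<open>W = F B\<^sub>1 - \<partial>\<^sub>y (F A\<^sub>1)\<close>.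
\<close>

lemma intertwines_quotientI:
  assumes F: "F holomorphic_on UNIV" and s: "s holomorphic_on UNIV"
    and simple: "\<And>z. s z = 0 \<Longrightarrow> deriv s z \<noteq> 0"
    and k: "\<And>z. s z \<noteq> 0 \<Longrightarrow> k z = F z / s z"
    and ab: "Im a = Im b"
    and A1: "A 1 = 0" "(A has_field_derivative B 1) (at 1)"
    and A2: "A (-1) = 0" "(A has_field_derivative B (-1)) (at (-1))"
    and A: "\<And>\<xi> y. A \<xi> - A y = s (\<xi> - y) * A\<^sub>1 \<xi> y"
    and B: "\<And>\<xi> y. B \<xi> - B y = s (\<xi> - y) * B\<^sub>1 \<xi> y"
    and C: "\<And>\<xi> y. C \<xi> - C y = s (\<xi> - y) * C\<^sub>1 \<xi> y"
    and P: "\<And>\<xi> y. ((\<lambda>y. F (\<xi> - y) * A\<^sub>1 \<xi> y) has_field_derivative F (\<xi> - y) * B\<^sub>1 \<xi> y - W \<xi> y) (at y)"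
    and W: "\<And>\<xi> y. (W \<xi> has_field_derivative F (\<xi> - y) * C\<^sub>1 \<xi> y) (at y)"
  shows "intertwines k (A, B, C) a b"
proof (rule simple_pole_kernel.intertwinesI[OF simple_pole_kernel_quotient[OF F s simple k] ab A1 A2])
  fix \<xi>
  have mult: "remove_sings k (\<xi> - y) * (s (\<xi> - y) * c) = F (\<xi> - y) * c" if "\<not> is_pole k (\<xi> - y)" for y c
    unfolding mult.assoc[symmetric] by (simp add: remove_sings_quotient[OF F s simple k that])
  show "\<exists>P P' W W'.
      (\<forall>y. (P has_field_derivative P' y) (at y)) \<and> (\<forall>y. (W has_field_derivative W' y) (at y)) \<and>
      (\<forall>y. \<not> is_pole k (\<xi> - y) \<longrightarrow>
         remove_sings k (\<xi> - y) * (A \<xi> - A y) = P y \<and>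
         remove_sings k (\<xi> - y) * (B \<xi> - B y) = W y + P' y \<and>
         remove_sings k (\<xi> - y) * (C \<xi> - C y) = W' y)"
    by (rule exI[of _ "\<lambda>y. F (\<xi> - y) * A\<^sub>1 \<xi> y"], rule exI[of _ "\<lambda>y. F (\<xi> - y) * B\<^sub>1 \<xi> y - W \<xi> y"],
        rule exI[of _ "W \<xi>"], rule exI[of _ "\<lambda>y. F (\<xi> - y) * C\<^sub>1 \<xi> y"])
       (simp add: P W A B C mult)
qed auto

section \<open>The hyperbolic and the rational families\<close>

lemma cosh_complex_neq_0: "cosh z \<noteq> 0" if "sinh z = 0" for z :: complex
  using hyperbolic_pythagoras[of z] that by auto

text \<open>
  Both hyperbolic families at once: \<open>F'' = \<mu>\<^sup>2 F\<close>, where a term with \<open>\<beta> \<noteq> 0\<close> is only possible for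
  constant \<open>F\<close>. The factorisation of the coefficient differences comes from
  \<open>cosh p - cosh q = 2 sinh ((p + q) / 2) sinh ((p - q) / 2)\<close> and the corresponding formula for \<open>sinh\<close>.
\<close>

lemma intertwines_sinh:
  fixes lam :: complex
  assumes lam: "lam \<noteq> 0"
    and F: "\<And>z. (F has_field_derivative F' z) (at z)"
    and F': "\<And>z. (F' has_field_derivative \<mu>\<^sup>2 * F z) (at z)"
    and \<beta>: "\<And>z. \<beta> * F' z = 0"
    and k: "k = (\<lambda>z. F z / sinh (lam / 2 * z))"
    and ab: "Im a = Im b"
    and A: "A = (\<lambda>y. \<alpha> * (cosh (lam * y) - cosh lam))"
    and B: "B = (\<lambda>y. \<alpha> * (lam * sinh (lam * y)) + \<beta> * (cosh (lam * y) - cosh lam))"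
    and C: "C = (\<lambda>y. \<beta> / 2 * (lam * sinh (lam * y)) + (lam\<^sup>2 / 4 - \<mu>\<^sup>2) * (\<alpha> * (cosh (lam * y) - cosh lam)))"
  shows "intertwines k (A, B, C) a b"
proof -
  \<comment> \<open>With \<open>h = lam / 2\<close> every identity below is polynomial in \<open>h\<close> and the hyperbolic functions.\<close>
  define h where "h = lam / 2"
  have h: "lam = 2 * h" "h \<noteq> 0" using lam by (simp_all add: h_def)
  let ?S = "\<lambda>\<xi> y. sinh (h * (\<xi> + y))" and ?C = "\<lambda>\<xi> y. cosh (h * (\<xi> + y))"
  let ?s = "\<lambda>z. sinh (h * z)"
  let ?A = "\<lambda>\<xi> y. 2 * \<alpha> * ?S \<xi> y" and ?B = "\<lambda>\<xi> y. 4 * \<alpha> * h * ?C \<xi> y + 2 * \<beta> * ?S \<xi> y"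
    and ?G = "\<lambda>\<xi> y. 2 * \<beta> * h * ?C \<xi> y + 2 * \<alpha> * (h * h - \<mu> * \<mu>) * ?S \<xi> y"
  let ?W = "\<lambda>\<xi> y. \<alpha> * (2 * ?S \<xi> y * F' (\<xi> - y) + 2 * h * ?C \<xi> y * F (\<xi> - y)) + 2 * \<beta> * ?S \<xi> y * F (\<xi> - y)"
  have B': "B = (\<lambda>y. 2 * \<alpha> * h * sinh (2 * h * y) + \<beta> * (cosh (2 * h * y) - cosh (2 * h)))"
    and C': "C = (\<lambda>y. \<beta> * h * sinh (2 * h * y) + (h * h - \<mu> * \<mu>) * \<alpha> * (cosh (2 * h * y) - cosh (2 * h)))"
    unfolding B C h(1) by (intro ext, simp add: field_simps power2_eq_square)+
  have arg: "2 * h * \<xi> = h * (\<xi> + y) + h * (\<xi> - y)" "2 * h * y = h * (\<xi> + y) - h * (\<xi> - y)" for \<xi> y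
    by (simp_all add: algebra_simps)
  have cosh: "cosh (2 * h * \<xi>) = cosh (2 * h * y) + ?s (\<xi> - y) * (2 * ?S \<xi> y)" for \<xi> y
    by (simp only: arg(1)[of \<xi> y] arg(2)[of y \<xi>] cosh_add cosh_diff) algebra
  have sinh: "sinh (2 * h * \<xi>) = sinh (2 * h * y) + ?s (\<xi> - y) * (2 * ?C \<xi> y)" for \<xi> y
    by (simp only: arg(1)[of \<xi> y] arg(2)[of y \<xi>] sinh_add sinh_diff) algebra
  have dA: "(A has_field_derivative 2 * \<alpha> * h * sinh (2 * h * y)) (at y)" for y
    unfolding A h(1) by (rule DERIV_cong, (rule derivative_intros)+, algebra)
  have ds: "(?s has_field_derivative h * cosh (h * z)) (at z)" for z
    by (rule DERIV_cong, (rule derivative_intros)+, algebra)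
  have dsub: "((\<lambda>y. \<xi> - y) has_field_derivative -1) (at y)" for \<xi> y :: complex
    by (auto intro!: derivative_eq_intros)
  have dF: "((\<lambda>y. F (\<xi> - y)) has_field_derivative F' (\<xi> - y) * -1) (at y)" for \<xi> y
    by (rule DERIV_chain2[where f = F and g = "\<lambda>y. \<xi> - y", OF F dsub])
  have dF': "((\<lambda>y. F' (\<xi> - y)) has_field_derivative \<mu>\<^sup>2 * F (\<xi> - y) * -1) (at y)" for \<xi> y
    by (rule DERIV_chain2[where f = F' and g = "\<lambda>y. \<xi> - y", OF F' dsub])
  show ?thesis
  proof (rule intertwines_quotientI[where F = F and s = ?s and A\<^sub>1 = ?A and B\<^sub>1 = ?B and C\<^sub>1 = ?G and W = ?W])
    show "F holomorphic_on UNIV" using F by (auto simp: holomorphic_on_open)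
    show "?s holomorphic_on UNIV" using ds by (auto simp: holomorphic_on_open)
    show "deriv ?s z \<noteq> 0" if "?s z = 0" for z
      using h(2) cosh_complex_neq_0[OF that] DERIV_imp_deriv[OF ds[of z]] by simp
    show "A 1 = 0" "A (-1) = 0" by (simp_all add: A)
    show "(A has_field_derivative B 1) (at 1)" "(A has_field_derivative B (-1)) (at (-1))"
      using dA[of 1] dA[of "-1"] by (simp_all add: B')
    fix \<xi> y
    show "A \<xi> - A y = ?s (\<xi> - y) * ?A \<xi> y"
      unfolding A h(1) cosh[of \<xi> y] by algebra
    show "B \<xi> - B y = ?s (\<xi> - y) * ?B \<xi> y"
      unfolding B' cosh[of \<xi> y] sinh[of \<xi> y] by algebra
    show "C \<xi> - C y = ?s (\<xi> - y) * ?G \<xi> y"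
      unfolding C' cosh[of \<xi> y] sinh[of \<xi> y] by algebra
    show "((\<lambda>y. F (\<xi> - y) * ?A \<xi> y) has_field_derivative F (\<xi> - y) * ?B \<xi> y - ?W \<xi> y) (at y)"
      by (rule DERIV_cong, (rule derivative_intros dF)+, algebra)
    show "(?W \<xi> has_field_derivative F (\<xi> - y) * ?G \<xi> y) (at y)"
      by (rule DERIV_cong, (rule derivative_intros dF dF')+, use \<beta>[of "\<xi> - y"] in algebra)
  qed (use k ab h_def in auto)
qed

lemma intertwines_inverse_plus_const:
  fixes \<beta> b :: complex
  assumes "\<beta> \<noteq> 0" and ab: "Im a = Im b'"
    and k: "k = (\<lambda>z. 1 / \<beta> + 1 / z)"
    and A: "A = (\<lambda>y. (y\<^sup>2 - 1) * (y\<^sup>2 - b\<^sup>2))"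
    and B: "B = (\<lambda>y. 4 * y ^ 3 - 2 * (1 + b\<^sup>2) * y + 2 * \<beta> * (y\<^sup>2 - 1))"
    and C: "C = (\<lambda>y. 2 * \<beta> * y)"
  shows "intertwines k (A, B, C) a b'"
proof -
  define c where "c = 1 / \<beta>"
  have c: "c * \<beta> = 1" using \<open>\<beta> \<noteq> 0\<close> by (simp add: c_def)
  let ?A = "\<lambda>\<xi> y. \<xi> ^ 3 + \<xi>\<^sup>2 * y + \<xi> * y\<^sup>2 + y ^ 3 - (1 + b\<^sup>2) * (\<xi> + y)"
  let ?B = "\<lambda>\<xi> y. 4 * (\<xi>\<^sup>2 + \<xi> * y + y\<^sup>2) - 2 * (1 + b\<^sup>2) + 2 * \<beta> * (\<xi> + y)"
  let ?W = "\<lambda>\<xi> y. (1 + c * (\<xi> - y)) * ?B \<xi> y + c * ?A \<xi> y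
      - (1 + c * (\<xi> - y)) * (\<xi>\<^sup>2 + 2 * \<xi> * y + 3 * y\<^sup>2 - (1 + b\<^sup>2))"
  show ?thesis
  proof (rule intertwines_quotientI[where F = "\<lambda>z. 1 + c * z" and s = "\<lambda>z. z" and A\<^sub>1 = ?A
        and B\<^sub>1 = ?B and C\<^sub>1 = "\<lambda>\<xi> y. 2 * \<beta>" and W = ?W])
    show "k z = (1 + c * z) / z" if "z \<noteq> 0" for z
      using that by (simp add: k c_def add_divide_distrib)
    show "(A has_field_derivative B 1) (at 1)" "(A has_field_derivative B (-1)) (at (-1))"
      unfolding A B power2_eq_square power3_eq_cube
      by (rule DERIV_cong, (rule derivative_intros)+, algebra)+
    fix \<xi> y
    show "A \<xi> - A y = (\<xi> - y) * ?A \<xi> y" "B \<xi> - B y = (\<xi> - y) * ?B \<xi> y" "C \<xi> - C y = (\<xi> - y) * (2 * \<beta>)"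
      unfolding A B C by algebra+
    show "((\<lambda>y. (1 + c * (\<xi> - y)) * ?A \<xi> y) has_field_derivative (1 + c * (\<xi> - y)) * ?B \<xi> y - ?W \<xi> y) (at y)"
      unfolding power2_eq_square power3_eq_cube
      by (rule DERIV_cong, (rule derivative_intros)+, algebra)
    show "(?W \<xi> has_field_derivative (1 + c * (\<xi> - y)) * (2 * \<beta>)) (at y)"
      unfolding power2_eq_square power3_eq_cube
      by (rule DERIV_cong, (rule derivative_intros)+, use c in algebra)
  qed (auto simp: A ab intro!: holomorphic_intros)
qed

lemma intertwines_inverse:
  fixes \<beta> a b :: complex
  assumes ab: "Im a = Im b"
    and k: "k = (\<lambda>z. 1 / z)"
    and A: "A = (\<lambda>y. (y\<^sup>2 - 1) * (y - a) * (y - b))"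
    and B: "B = (\<lambda>y. 4 * y ^ 3 - 3 * (a + b) * y\<^sup>2 + 2 * (a * b - 1) * y + (a + b) + \<beta> * (y\<^sup>2 - 1))"
    and C: "C = (\<lambda>y. 2 * y\<^sup>2 + (\<beta> - a - b) * y)"
  shows "intertwines k (A, B, C) a b"
proof -
  let ?A = "\<lambda>\<xi> y. \<xi> ^ 3 + \<xi>\<^sup>2 * y + \<xi> * y\<^sup>2 + y ^ 3 - (a + b) * (\<xi>\<^sup>2 + \<xi> * y + y\<^sup>2)
      + (a * b - 1) * (\<xi> + y) + (a + b)"
  let ?B = "\<lambda>\<xi> y. 4 * (\<xi>\<^sup>2 + \<xi> * y + y\<^sup>2) - 3 * (a + b) * (\<xi> + y) + 2 * (a * b - 1) + \<beta> * (\<xi> + y)"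
  let ?C = "\<lambda>\<xi> y. 2 * (\<xi> + y) + (\<beta> - a - b)"
  let ?W = "\<lambda>\<xi> y. ?B \<xi> y - (\<xi>\<^sup>2 + 2 * \<xi> * y + 3 * y\<^sup>2 - (a + b) * (\<xi> + 2 * y) + (a * b - 1))"
  show ?thesis
  proof (rule intertwines_quotientI[where F = "\<lambda>z. 1" and s = "\<lambda>z. z" and A\<^sub>1 = ?A
        and B\<^sub>1 = ?B and C\<^sub>1 = ?C and W = ?W])
    show "(A has_field_derivative B 1) (at 1)" "(A has_field_derivative B (-1)) (at (-1))"
      unfolding A B power2_eq_square power3_eq_cube
      by (rule DERIV_cong, (rule derivative_intros)+, algebra)+
    fix \<xi> y
    show "A \<xi> - A y = (\<xi> - y) * ?A \<xi> y" "B \<xi> - B y = (\<xi> - y) * ?B \<xi> y" "C \<xi> - C y = (\<xi> - y) * ?C \<xi> y"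
      unfolding A B C by algebra+
    show "((\<lambda>y. 1 * ?A \<xi> y) has_field_derivative 1 * ?B \<xi> y - ?W \<xi> y) (at y)"
      unfolding power2_eq_square power3_eq_cube
      by (rule DERIV_cong, (rule derivative_intros)+, algebra)
    show "(?W \<xi> has_field_derivative 1 * ?C \<xi> y) (at y)"
      unfolding power2_eq_square power3_eq_cube
      by (rule DERIV_cong, (rule derivative_intros)+, algebra)
  qed (auto simp: A k ab)
qed

section \<open>Self-adjointness\<close>

text \<open>
  Equality of the coefficients of \<open>L\<close> and its adjoint, given the ordinary derivatives of \<open>A\<close> and \<open>B\<close>.
  The functions \<open>cnj A\<close> and \<open>cnj B\<close> agree on the segment with the holomorphic functions \<open>A\<close> and \<open>2 A' - B\<close>,
  so they can be differentiated within it.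
\<close>

lemma self_adjointI:
  assumes dA: "\<And>y. (A has_field_derivative A' y) (at y)"
    and dA': "\<And>y. (A' has_field_derivative A'' y) (at y)"
    and dB: "\<And>y. (B has_field_derivative B' y) (at y)"
    and A: "\<And>x. x \<in> open_segment a b \<Longrightarrow> cnj (A x) = A x"
    and B: "\<And>x. x \<in> open_segment a b \<Longrightarrow> B x + cnj (B x) = 2 * A' x"
    and C: "\<And>x. x \<in> open_segment a b \<Longrightarrow> C x - cnj (C x) = B' x - A'' x"
  shows "expr_eq_on (open_segment a b) (adjoint_expr (open_segment a b) (A, B, C)) (A, B, C)"
proof -
  let ?S = "open_segment a b"
  have deriv_eq: "deriv_within ?S f x = g' x"
    if "x \<in> ?S" "\<And>y. (g has_field_derivative g' y) (at y)" "\<And>y. y \<in> ?S \<Longrightarrow> f y = g y" for f g g' x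
  proof (rule deriv_within_eq)
    show "(f has_field_derivative g' x) (at x within ?S)"
      using has_field_derivative_at_within[OF that(2)]
      by (rule has_field_derivative_transform_within[where d = 1]) (use that in auto)
  qed (rule at_within_open_segment_neq_bot[OF that(1)])
  have 1: "deriv_within ?S (\<lambda>y. cnj (A y)) x = A' x" if "x \<in> ?S" for x
    by (rule deriv_eq[OF that dA]) (rule A)
  have 2: "deriv_within ?S (deriv_within ?S (\<lambda>y. cnj (A y))) x = A'' x" if "x \<in> ?S" for x
    by (rule deriv_eq[OF that dA']) (rule 1)
  have cnjB: "cnj (B x) = 2 * A' x - B x" if "x \<in> ?S" for x
    using B[OF that] by (simp add: eq_diff_eq add.commute)
  have 3: "deriv_within ?S (\<lambda>y. cnj (B y)) x = 2 * A'' x - B' x" if "x \<in> ?S" for x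
    by (rule deriv_eq[OF that, of "\<lambda>y. 2 * A' y - B y"])
       (auto intro!: derivative_eq_intros dA' dB cnjB)
  have 4: "B' x - A'' x + cnj (C x) = C x" if "x \<in> ?S" for x
    using C[OF that] by (simp only: diff_eq_eq)
  show ?thesis
    by (simp add: A 1 2 3 4 cnjB)
qed

lemma cnj_eq_on_real_segment:
  assumes "x \<in> open_segment a b" "Im a = 0" "Im b = 0"
  shows "cnj x = x"
  using Im_open_segment_horizontal[of a b x] assms by (simp add: complex_eq_iff)

lemma in_translated_segment:
  fixes x c :: complex
  assumes "x \<in> open_segment (-1 + c) (1 + c)"
  obtains t where "x = of_real t + c"
proof -
  obtain u where "x = (1 - u) *\<^sub>R (-1 + c) + u *\<^sub>R (1 + c)"
    using assms by (auto simp: in_segment)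
  then have "x = of_real (2 * u - 1) + c"
    by (simp add: scaleR_conv_of_real algebra_simps)
  then show thesis by (rule that)
qed

text \<open>
  On the segment, \<open>cosh (lam x)\<close> and \<open>lam sinh (lam x)\<close> are real: for real \<open>lam\<close>, the shift changes \<open>lam x\<close>
  by a multiple of the period; for imaginary \<open>lam\<close>, \<open>x\<close> is real and conjugation changes the sign of
  \<open>lam\<close>.
\<close>

lemma cosh_sinh_real:
  fixes lam :: complex and n :: int
  assumes lam: "lam \<in> \<real> \<or> Re lam = 0" "lam \<noteq> 0"
    and x: "x = of_real t + 2 * of_real pi * \<i> * of_int n / lam"
  shows "cnj (cosh (lam * x)) = cosh (lam * x)" "cnj (lam * sinh (lam * x)) = lam * sinh (lam * x)"
proof -
  have cnj_cosh: "cnj (cosh z) = cosh (cnj z)" and cnj_sinh: "cnj (sinh z) = sinh (cnj z)" for z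
    by (simp_all add: cosh_field_def sinh_field_def exp_cnj)
  have "cnj lam = lam \<and> cosh (cnj (lam * x)) = cosh (lam * x) \<and> sinh (cnj (lam * x)) = sinh (lam * x) \<or>
      cnj lam = - lam \<and> cnj (lam * x) = - (lam * x)"
    using lam(1)
  proof
    assume "lam \<in> \<real>"
    then have "cnj lam = lam" using Reals_cnj_iff by blast
    have lx: "lam * x = lam * of_real t + \<i> * (of_int n * (of_real pi * 2))"
      using lam(2) by (simp add: x algebra_simps)
    have "cnj (lam * x) = lam * of_real t + \<i> * (of_int (- n) * (of_real pi * 2))"
      unfolding lx using \<open>cnj lam = lam\<close> by simp
    moreover have "exp (z + \<i> * (of_int m * (of_real pi * 2))) = exp z \<and>
        exp (- (z + \<i> * (of_int m * (of_real pi * 2)))) = exp (- z)" for z and m :: int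
      using exp_plus_2pin[of z m] exp_plus_2pin[of "- z" "- m"] by (simp add: algebra_simps)
    ultimately have "exp (cnj (lam * x)) = exp (lam * x)" "exp (- cnj (lam * x)) = exp (- (lam * x))"
      by (simp_all only: lx)
    with \<open>cnj lam = lam\<close> show ?thesis by (simp add: cosh_field_def sinh_field_def)
  next
    assume "Re lam = 0"
    then have "cnj lam = - lam" by (simp add: complex_eq_iff)
    moreover from this have "cnj x = x" by (simp add: x)
    ultimately show ?thesis by simp
  qed
  then show "cnj (cosh (lam * x)) = cosh (lam * x)" "cnj (lam * sinh (lam * x)) = lam * sinh (lam * x)"
    unfolding cnj_cosh complex_cnj_mult cnj_sinh by auto
qed

lemma cnj_square: "cnj (z\<^sup>2) = z\<^sup>2" if "z \<in> \<real> \<or> Re z = 0"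
  using that by (auto simp: complex_eq_iff power2_eq_square elim!: Reals_cases)

lemma DERIV_cosh_minus_cosh:
  fixes c lam y :: complex
  shows "((\<lambda>y. c * (cosh (lam * y) - cosh lam)) has_field_derivative c * (lam * sinh (lam * y))) (at y)"
  by (auto intro!: derivative_eq_intros)

lemma self_adjoint_sinh:
  fixes lam \<mu> \<alpha> \<beta> :: complex and n :: int
  assumes lam: "lam \<in> \<real> \<or> Re lam = 0" "lam \<noteq> 0" and \<mu>: "\<mu> \<in> \<real> \<or> Re \<mu> = 0"
    and \<alpha>: "cnj \<alpha> = \<alpha>" and \<beta>: "Re \<beta> = 0"
    and a: "a = -1 + 2 * of_real pi * \<i> * of_int n / lam"
    and b: "b = 1 + 2 * of_real pi * \<i> * of_int n / lam"
    and A: "A = (\<lambda>y. \<alpha> * (cosh (lam * y) - cosh lam))"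
    and B: "B = (\<lambda>y. \<alpha> * (lam * sinh (lam * y)) + \<beta> * (cosh (lam * y) - cosh lam))"
    and C: "C = (\<lambda>y. \<beta> / 2 * (lam * sinh (lam * y)) + (lam\<^sup>2 / 4 - \<mu>\<^sup>2) * (\<alpha> * (cosh (lam * y) - cosh lam)))"
  shows "expr_eq_on (open_segment a b) (adjoint_expr (open_segment a b) (A, B, C)) (A, B, C)"
proof (rule self_adjointI)
  show "(A has_field_derivative \<alpha> * (lam * sinh (lam * y))) (at y)" for y
    unfolding A by (rule DERIV_cosh_minus_cosh)
  show "((\<lambda>y. \<alpha> * (lam * sinh (lam * y))) has_field_derivative \<alpha> * (lam\<^sup>2 * cosh (lam * y))) (at y)" for y
    by (auto intro!: derivative_eq_intros simp: power2_eq_square)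
  show "(B has_field_derivative \<alpha> * (lam\<^sup>2 * cosh (lam * y)) + \<beta> * (lam * sinh (lam * y))) (at y)" for y
    unfolding B by (auto intro!: derivative_eq_intros simp: power2_eq_square)
  have \<beta>': "cnj \<beta> = - \<beta>" using \<beta> by (simp add: complex_eq_iff)
  have cosh_1: "cnj (cosh lam) = cosh lam"
    using cosh_sinh_real(1)[OF lam, of 1 1 0] by simp
  fix x assume "x \<in> open_segment a b"
  then obtain t where "x = of_real t + 2 * of_real pi * \<i> * of_int n / lam"
    unfolding a b by (rule in_translated_segment)
  note real = cosh_sinh_real[OF lam this] cosh_1
  show "cnj (A x) = A x"
    by (simp add: A \<alpha> real)
  show "B x + cnj (B x) = 2 * (\<alpha> * (lam * sinh (lam * x)))"
    unfolding B complex_cnj_add complex_cnj_mult[of \<alpha>] complex_cnj_mult[of \<beta>] complex_cnj_diff real \<alpha> \<beta>'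
    by (simp add: algebra_simps)
  have sq: "cnj (lam\<^sup>2 / 4 - \<mu>\<^sup>2) = lam\<^sup>2 / 4 - \<mu>\<^sup>2"
    using cnj_square[OF lam(1)] cnj_square[OF \<mu>] by simp
  have half: "cnj (\<beta> / 2) = - (\<beta> / 2)" using \<beta>' by simp
  show "C x - cnj (C x) = \<alpha> * (lam\<^sup>2 * cosh (lam * x)) + \<beta> * (lam * sinh (lam * x)) - \<alpha> * (lam\<^sup>2 * cosh (lam * x))"
    unfolding C complex_cnj_add complex_cnj_mult[of \<alpha>] complex_cnj_mult[of "\<beta> / 2"]
      complex_cnj_mult[of "lam\<^sup>2 / 4 - \<mu>\<^sup>2"] complex_cnj_diff[of "cosh (lam * x)"] real \<alpha> sq half
    by simp
qed

lemma self_adjoint_polynomial: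
  fixes A B C :: "complex \<Rightarrow> complex"
  assumes ab: "Im a = 0" "Im b = 0" and \<beta>: "Re \<beta> = 0"
    and dA: "\<And>y. (A has_field_derivative A' y) (at y)"
    and dA': "\<And>y. (A' has_field_derivative A'' y) (at y)"
    and A: "\<And>x. cnj (A x) = A (cnj x)" "\<And>x. cnj (A' x) = A' (cnj x)"
    and B: "B = (\<lambda>y. A' y + \<beta> * (y\<^sup>2 - 1))"
    and C: "\<And>x. cnj x = x \<Longrightarrow> C x - cnj (C x) = 2 * \<beta> * x"
  shows "expr_eq_on (open_segment a b) (adjoint_expr (open_segment a b) (A, B, C)) (A, B, C)"
proof (rule self_adjointI[OF dA dA'])
  show "(B has_field_derivative A'' y + 2 * \<beta> * y) (at y)" for y
    unfolding B by (auto intro!: derivative_eq_intros dA')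
  have \<beta>': "cnj \<beta> = - \<beta>" using \<beta> by (simp add: complex_eq_iff)
  fix x assume "x \<in> open_segment a b"
  then have x: "cnj x = x" using cnj_eq_on_real_segment ab by blast
  show "cnj (A x) = A x" by (simp add: A x)
  show "B x + cnj (B x) = 2 * A' x" by (simp add: B A x \<beta>')
  show "C x - cnj (C x) = A'' x + 2 * \<beta> * x - A'' x" by (simp add: C x)
qed

section \<open>The intertwining self-adjoint expressions\<close>

theorem corollary2:
  fixes k A B C :: "complex \<Rightarrow> complex" and a b :: complex
  assumes smooth: "smooth_within (complex_of_real ` ({-2..2} - {0})) (remove_sings k)"
    and choice:
    "(\<exists>(lam::complex) (\<mu>::complex) (\<alpha>\<^sub>1::complex) (\<alpha>\<^sub>2::complex) (n::int).
        (lam \<in> \<real> \<or> Re lam = 0) \<and> (\<mu> \<in> \<real> \<or> Re \<mu> = 0) \<and> lam \<noteq> 0 \<and>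
        (Re lam = 0 \<longrightarrow>
           norm lam < pi \<or>
           (pi \<le> norm lam \<and> norm lam < 2 * pi \<and> \<alpha>\<^sub>1 = 0 \<and>
            (\<exists>m::int. \<mu> = lam * (2 * of_int m + 1) / 4))) \<and>
        k = (\<lambda>z. lam / sinh (lam / 2 * z) *
               (\<alpha>\<^sub>1 * (if \<mu> = 0 then z else sinh (\<mu> * z) / \<mu>) + \<alpha>\<^sub>2 * cosh (\<mu> * z))) \<and>
        A = (\<lambda>y. 1 / lam\<^sup>2 * (cosh (lam * y) - cosh lam)) \<and>
        B = deriv A \<and>
        C = (\<lambda>y. (lam\<^sup>2 / 4 - \<mu>\<^sup>2) * A y) \<and>
        a = -1 + 2 * of_real pi * \<i> * of_int n / lam \<and>
        b = 1 + 2 * of_real pi * \<i> * of_int n / lam)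
     \<or>
     (\<exists>(lam::complex) (\<alpha>::real) (\<beta>::complex) (n::int) (A\<^sub>0::complex \<Rightarrow> complex).
        (lam \<in> \<real> \<or> Re lam = 0) \<and> lam \<noteq> 0 \<and> Re \<beta> = 0 \<and>
        A\<^sub>0 = (\<lambda>y. cosh (lam * y) - cosh lam) \<and>
        k = (\<lambda>z. 1 / sinh (lam / 2 * z)) \<and>
        A = (\<lambda>y. of_real \<alpha> * A\<^sub>0 y) \<and>
        B = (\<lambda>y. of_real \<alpha> * deriv A\<^sub>0 y + \<beta> * A\<^sub>0 y) \<and>
        C = (\<lambda>y. \<beta> / 2 * deriv A\<^sub>0 y + of_real \<alpha> * (lam\<^sup>2 / 4) * A\<^sub>0 y) \<and>
        a = -1 + 2 * of_real pi * \<i> * of_int n / lam \<and>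
        b = 1 + 2 * of_real pi * \<i> * of_int n / lam)
     \<or>
     (\<exists>(\<beta>::complex) (b'::real).
        Re \<beta> = 0 \<and> \<beta> \<noteq> 0 \<and> b' > 0 \<and> b = of_real b' \<and> a = - b \<and>
        k = (\<lambda>z. 1 / \<beta> + 1 / z) \<and>
        A = (\<lambda>y. (y\<^sup>2 - 1) * (y\<^sup>2 - b\<^sup>2)) \<and>
        B = (\<lambda>y. deriv A y + 2 * \<beta> * (y\<^sup>2 - 1)) \<and>
        C = (\<lambda>y. 2 * \<beta> * y))
     \<or>
     (\<exists>(\<beta>::complex) (a'::real) (b'::real).
        Re \<beta> = 0 \<and> a' < b' \<and> a = of_real a' \<and> b = of_real b' \<and>
        k = (\<lambda>z. 1 / z) \<and>
        A = (\<lambda>y. (y\<^sup>2 - 1) * (y - a) * (y - b)) \<and>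
        B = (\<lambda>y. deriv A y + \<beta> * (y\<^sup>2 - 1)) \<and>
        C = (\<lambda>y. 2 * y\<^sup>2 + (\<beta> - a - b) * y))"
  shows "intertwines k (A, B, C) a b \<and>
    expr_eq_on (open_segment (-1) 1) (adjoint_expr (open_segment (-1) 1) (A, B, C)) (A, B, C) \<and>
    expr_eq_on (open_segment a b) (adjoint_expr (open_segment a b) (A, B, C)) (A, B, C)"
  \<comment> \<open>Only the three outer disjunctions are split; those on \<open>lam\<close> and \<open>\<mu>\<close> are kept as hypotheses.\<close>
proof (insert choice, erule disjE; (erule disjE; (erule disjE)?)?; elim exE conjE)
  fix lam \<mu> \<alpha>\<^sub>1 \<alpha>\<^sub>2 :: complex and n :: int
  assume lam: "lam \<in> \<real> \<or> Re lam = 0" "lam \<noteq> 0" and \<mu>: "\<mu> \<in> \<real> \<or> Re \<mu> = 0"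
    and k: "k = (\<lambda>z. lam / sinh (lam / 2 * z) *
               (\<alpha>\<^sub>1 * (if \<mu> = 0 then z else sinh (\<mu> * z) / \<mu>) + \<alpha>\<^sub>2 * cosh (\<mu> * z)))"
    and A: "A = (\<lambda>y. 1 / lam\<^sup>2 * (cosh (lam * y) - cosh lam))"
    and B: "B = deriv A" and C: "C = (\<lambda>y. (lam\<^sup>2 / 4 - \<mu>\<^sup>2) * A y)"
    and a: "a = -1 + 2 * of_real pi * \<i> * of_int n / lam"
    and b: "b = 1 + 2 * of_real pi * \<i> * of_int n / lam"
  let ?F = "\<lambda>z. lam * (\<alpha>\<^sub>1 * (if \<mu> = 0 then z else sinh (\<mu> * z) / \<mu>) + \<alpha>\<^sub>2 * cosh (\<mu> * z))"
  let ?F' = "\<lambda>z. lam * (\<alpha>\<^sub>1 * cosh (\<mu> * z) + \<alpha>\<^sub>2 * (\<mu> * sinh (\<mu> * z)))"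
  have F: "(?F has_field_derivative ?F' z) (at z)" for z
    by (cases "\<mu> = 0") (auto intro!: derivative_eq_intros)
  have F': "(?F' has_field_derivative \<mu>\<^sup>2 * ?F z) (at z)" for z
    by (cases "\<mu> = 0") (auto intro!: derivative_eq_intros simp: power2_eq_square algebra_simps)
  have k': "k = (\<lambda>z. ?F z / sinh (lam / 2 * z))"
    by (simp add: k)
  \<comment> \<open>The first family is the case \<open>\<beta> = 0\<close> of the general hyperbolic expression.\<close>
  have B': "B = (\<lambda>y. 1 / lam\<^sup>2 * (lam * sinh (lam * y)) + 0 * (cosh (lam * y) - cosh lam))"
    unfolding B A by (intro ext DERIV_imp_deriv) (simp only: mult_zero_left add_0_right DERIV_cosh_minus_cosh)
  have C': "C = (\<lambda>y. 0 / 2 * (lam * sinh (lam * y)) +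
      (lam\<^sup>2 / 4 - \<mu>\<^sup>2) * (1 / lam\<^sup>2 * (cosh (lam * y) - cosh lam)))"
    by (simp add: C A)
  have "intertwines k (A, B, C) a b"
    by (rule intertwines_sinh[OF lam(2) F F' _ k' _ A B' C']) (simp_all add: a b)
  moreover have "cnj (1 / lam\<^sup>2) = 1 / lam\<^sup>2"
    using cnj_square[OF lam(1)] by simp
  \<comment> \<open>The segment \<open>(-1, 1)\<close> is the one with \<open>n = 0\<close>.\<close>
  note self_adjoint_sinh[OF lam \<mu> this _ _ _ A B' C']
  from this[OF _ a b] this[of "-1" 0 1]
  have "expr_eq_on (open_segment a b) (adjoint_expr (open_segment a b) (A, B, C)) (A, B, C)"
    "expr_eq_on (open_segment (-1) 1) (adjoint_expr (open_segment (-1) 1) (A, B, C)) (A, B, C)"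
    by simp_all
  ultimately show ?thesis by blast
next
  fix lam \<beta> :: complex and \<alpha> :: real and n :: int and A\<^sub>0
  assume lam: "lam \<in> \<real> \<or> Re lam = 0" "lam \<noteq> 0" and \<beta>: "Re \<beta> = 0"
    and A\<^sub>0: "A\<^sub>0 = (\<lambda>y. cosh (lam * y) - cosh lam)"
    and k: "k = (\<lambda>z. 1 / sinh (lam / 2 * z))"
    and A: "A = (\<lambda>y. of_real \<alpha> * A\<^sub>0 y)"
    and B: "B = (\<lambda>y. of_real \<alpha> * deriv A\<^sub>0 y + \<beta> * A\<^sub>0 y)"
    and C: "C = (\<lambda>y. \<beta> / 2 * deriv A\<^sub>0 y + of_real \<alpha> * (lam\<^sup>2 / 4) * A\<^sub>0 y)"
    and a: "a = -1 + 2 * of_real pi * \<i> * of_int n / lam"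
    and b: "b = 1 + 2 * of_real pi * \<i> * of_int n / lam"
  \<comment> \<open>Here \<open>F = 1\<close> and \<open>\<mu> = 0\<close>.\<close>
  have dA\<^sub>0: "deriv A\<^sub>0 = (\<lambda>y. lam * sinh (lam * y))"
    unfolding A\<^sub>0 by (intro ext DERIV_imp_deriv) (auto intro!: derivative_eq_intros)
  have A': "A = (\<lambda>y. of_real \<alpha> * (cosh (lam * y) - cosh lam))"
    and B': "B = (\<lambda>y. of_real \<alpha> * (lam * sinh (lam * y)) + \<beta> * (cosh (lam * y) - cosh lam))"
    and C': "C = (\<lambda>y. \<beta> / 2 * (lam * sinh (lam * y)) + (lam\<^sup>2 / 4 - 0\<^sup>2) * (of_real \<alpha> * (cosh (lam * y) - cosh lam)))"
    unfolding A B C dA\<^sub>0 unfolding A\<^sub>0 by (simp_all add: mult_ac)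
  have "intertwines k (A, B, C) a b"
    by (rule intertwines_sinh[OF lam(2), where F = "\<lambda>z. 1" and F' = "\<lambda>z. 0", OF _ _ _ k _ A' B' C'])
       (simp_all add: a b)
  moreover note self_adjoint_sinh[OF lam _ _ \<beta> _ _ A' B' C']
  from this[OF _ _ a b] this[of "-1" 0 1]
  have "expr_eq_on (open_segment a b) (adjoint_expr (open_segment a b) (A, B, C)) (A, B, C)"
    "expr_eq_on (open_segment (-1) 1) (adjoint_expr (open_segment (-1) 1) (A, B, C)) (A, B, C)"
    by simp_all
  ultimately show ?thesis by blast
next
  fix \<beta> :: complex and b' :: real
  assume \<beta>: "Re \<beta> = 0" "\<beta> \<noteq> 0" and b: "b = of_real b'" and a: "a = - b"
    and k: "k = (\<lambda>z. 1 / \<beta> + 1 / z)"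
    and A: "A = (\<lambda>y. (y\<^sup>2 - 1) * (y\<^sup>2 - b\<^sup>2))"
    and B: "B = (\<lambda>y. deriv A y + 2 * \<beta> * (y\<^sup>2 - 1))"
    and C: "C = (\<lambda>y. 2 * \<beta> * y)"
  let ?A' = "\<lambda>y. 4 * y ^ 3 - 2 * (1 + b\<^sup>2) * y"
  have dA: "(A has_field_derivative ?A' y) (at y)" for y
    unfolding A power2_eq_square power3_eq_cube by (rule DERIV_cong, (rule derivative_intros)+, algebra)
  have dA': "(?A' has_field_derivative 12 * y\<^sup>2 - 2 * (1 + b\<^sup>2)) (at y)" for y
    unfolding power2_eq_square power3_eq_cube by (rule DERIV_cong, (rule derivative_intros)+, algebra)
  have B': "B = (\<lambda>y. ?A' y + 2 * \<beta> * (y\<^sup>2 - 1))"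
    unfolding B using DERIV_imp_deriv[OF dA] by simp
  have int: "intertwines k (A, B, C) a b"
    by (rule intertwines_inverse_plus_const[OF \<beta>(2) _ k A B' C]) (simp add: a b)
  have adj: "expr_eq_on (open_segment p q) (adjoint_expr (open_segment p q) (A, B, C)) (A, B, C)"
    if "Im p = 0" "Im q = 0" for p q
    by (rule self_adjoint_polynomial[OF that _ dA dA' _ _ B'])
       (use \<beta> in \<open>auto simp: A b C complex_eq_iff\<close>)
  show ?thesis by (intro conjI int adj) (simp_all add: a b)
next
  fix \<beta> :: complex and a' b' :: real
  assume \<beta>: "Re \<beta> = 0" and a: "a = of_real a'" and b: "b = of_real b'"
    and k: "k = (\<lambda>z. 1 / z)"
    and A: "A = (\<lambda>y. (y\<^sup>2 - 1) * (y - a) * (y - b))"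
    and B: "B = (\<lambda>y. deriv A y + \<beta> * (y\<^sup>2 - 1))"
    and C: "C = (\<lambda>y. 2 * y\<^sup>2 + (\<beta> - a - b) * y)"
  let ?A' = "\<lambda>y. 4 * y ^ 3 - 3 * (a + b) * y\<^sup>2 + 2 * (a * b - 1) * y + (a + b)"
  have dA: "(A has_field_derivative ?A' y) (at y)" for y
    unfolding A power2_eq_square power3_eq_cube by (rule DERIV_cong, (rule derivative_intros)+, algebra)
  have dA': "(?A' has_field_derivative 12 * y\<^sup>2 - 6 * (a + b) * y + 2 * (a * b - 1)) (at y)" for y
    unfolding power2_eq_square power3_eq_cube by (rule DERIV_cong, (rule derivative_intros)+, algebra)
  have B': "B = (\<lambda>y. ?A' y + \<beta> * (y\<^sup>2 - 1))"
    unfolding B using DERIV_imp_deriv[OF dA] by simp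
  have int: "intertwines k (A, B, C) a b"
    by (rule intertwines_inverse[OF _ k A B' C]) (simp add: a b)
  have \<beta>': "cnj \<beta> = - \<beta>" using \<beta> by (simp add: complex_eq_iff)
  have adj: "expr_eq_on (open_segment p q) (adjoint_expr (open_segment p q) (A, B, C)) (A, B, C)"
    if "Im p = 0" "Im q = 0" for p q
    by (rule self_adjoint_polynomial[OF that \<beta> dA dA' _ _ B'])
       (auto simp: A a b C \<beta>' algebra_simps)
  show ?thesis by (intro conjI int adj) (simp_all add: a b)
qed

end
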